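(* Let $\epsilon>0$ be the desired accuracy and let $R\ge1$ be the length of the recovery region, with $e^R=\mathcal{O}(1)$. Suppose $L>0$ satisfies $$e^{-\pi L+2\lambda_{\max}^+(H_1)T+R}\le\epsilon,\qquad e^{-\pi L+\lambda_{\max}^-(H_1)T+\lambda_{\max}^+(H_1)T+R}\le\epsilon .$$ Let $p^{\Diamond}\ge\lambda_{\max}^+(H_1)T$ and $\tilde\Omega_p=(p^{\Diamond},p^{\Diamond}+R)$. Then there is a constant $C>0$ independent of the numerical mesh size and time step such that $$\|\boldsymbol{u}_h^d(T)-\boldsymbol{u}(T)\|_{L^2(\tilde\Omega_p)}\le C\left(\triangle p\,e^{p^{\Diamond}}\|\boldsymbol{u}(T)\|+\epsilon\|\boldsymbol{u}_0\|\right),$$ where $\boldsymbol{u}(T)$ is regarded as a (constant) function of $p$ and $\boldsymbol{u}_h^d(T)=\boldsymbol{u}_h^d(T,p)$ as a function of $p\in\tilde\Omega_p$.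
   Context: Fix $T>0$, $n\ge1$, a time-dependent matrix $A(t)\in\mathbb{C}^{n\times n}$, $t\in[0,T]$, and $\boldsymbol{u}_0\in\mathbb{C}^n$; $\boldsymbol{u}$ solves $\frac{\mathrm{d}}{\mathrm{d}t}\boldsymbol{u}=A(t)\boldsymbol{u}$, $\boldsymbol{u}(0)=\boldsymbol{u}_0$. Write $H_1=(A+A^\dagger)/2$ and $H_2=(A-A^\dagger)/(2i)$, where $\dagger$ is the conjugate transpose. With $\sigma(\cdot)$ the set of eigenvalues, $\lambda_{\max}^+(H_1)=\max\{\sup_{0<t<T}\{|\lambda|:\lambda\in\sigma(H_1(t)),\lambda>0\},0\}$ and $\lambda_{\max}^-(H_1)=\max\{\sup_{0<t<T}\{|\lambda|:\lambda\in\sigma(H_1(t)),\lambda<0\},0\}$. The eigenvalues of $H_1$ are allowed to be positive. $\|\cdot\|$ is the Euclidean norm on $\mathbb{C}^n$. The number $p^{\Diamond}$ is any value with $p^{\Diamond}\ge\lambda_{\max}^+(H_1)T$. Discretization. For $L>0$ and an even positive integer $N_p$, let $\triangle p=2\pi L/N_p$, $p_k=-\pi L+k\triangle p$, $[N_p]=\{0,\dots,N_p-1\}$, $\mu_l=(l-N_p/2)/L$, $\phi_l(p)=e^{i\mu_l(p+\pi L)}$ for $l\in[N_p]$, $\Phi=(\phi_l(p_j))_{j,l\in[N_p]}$ and $D_p=\mathrm{diag}\{\mu_0,\dots,\mu_{N_p-1}\}$. Let $\tilde{\boldsymbol{w}}_h(t)\in\mathbb{C}^{N_p}\otimes\mathbb{C}^n$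 solve $$\frac{\mathrm{d}}{\mathrm{d}t}\tilde{\boldsymbol{w}}_h=-i(D_p\otimes H_1-I_{N_p}\otimes H_2)\tilde{\boldsymbol{w}}_h,\qquad \tilde{\boldsymbol{w}}_h(0)=(\Phi^{-1}\otimes I_n)\Big(\sum_{k\in[N_p]}e^{-|p_k|}|k\rangle\otimes\boldsymbol{u}_0\Big),$$ with $|k\rangle$ the $k$-th standard basis vector of $\mathbb{C}^{N_p}$ and $I_m$ the $m\times m$ identity. Set $\boldsymbol{w}_h^d(t,p)=\sum_{l\in[N_p]}\big[(\langle l|\otimes I_n)\tilde{\boldsymbol{w}}_h(t)\big]e^{i\mu_l(p+\pi L)}$ and $\boldsymbol{u}_h^d(t,p)=e^p\boldsymbol{w}_h^d(t,p)$ for $p\in(p^{\Diamond},p^{\Diamond}+R)$. *)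

theory Defs
  imports "HOL-Analysis.Analysis"
begin

section \<open>The linear system and its Hermitian splitting\<close>

definition conj_transpose :: "complex^'n^'n \<Rightarrow> complex^'n^'n" where
  "conj_transpose M = (\<chi> i j. cnj (M $ j $ i))"

text \<open>\<open>herm1 M\<close> is $(M + M^\dagger)/2$ and \<open>herm2 M\<close> is $(M - M^\dagger)/(2i)$.\<close>

definition herm1 :: "complex^'n^'n \<Rightarrow> complex^'n^'n" where
  "herm1 M = (\<chi> i j. (M + conj_transpose M) $ i $ j / 2)"

definition herm2 :: "complex^'n^'n \<Rightarrow> complex^'n^'n" where
  "herm2 M = (\<chi> i j. (M - conj_transpose M) $ i $ j / (2 * \<i>))"

definition eigenvalues :: "complex^'n^'n \<Rightarrow> complex set" where
  "eigenvalues M = {z. \<exists>v. v \<noteq> 0 \<and> M *v v = z *s v}"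

text \<open>
  The eigenvalues of the Hermitian matrix \<open>herm1 (A t)\<close> are real, so it suffices to let \<open>x\<close>
  range over the reals.  Inserting \<open>0\<close> below the supremum is the outer $\max\{\cdot, 0\}$; it
  also gives the value \<open>0\<close> when there is no eigenvalue of the given sign (the real \<open>Sup {}\<close> is
  unspecified).  The suprema are meaningful only if the eigenvalues are bounded over
  $0 < t < T$.
\<close>

definition lam_plus :: "real \<Rightarrow> (real \<Rightarrow> complex^'n^'n) \<Rightarrow> real" where
  "lam_plus T A = Sup (insert 0
     {\<bar>x\<bar> | x t. 0 < t \<and> t < T \<and> complex_of_real x \<in> eigenvalues (herm1 (A t)) \<and> x > 0})"

definition lam_minus :: "real \<Rightarrow> (real \<Rightarrow> complex^'n^'n) \<Rightarrow> real" where
  "lam_minus T A = Sup (insert 0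
     {\<bar>x\<bar> | x t. 0 < t \<and> t < T \<and> complex_of_real x \<in> eigenvalues (herm1 (A t)) \<and> x < 0})"

definition solves_linear_ode ::
    "real \<Rightarrow> (real \<Rightarrow> complex^'n^'n) \<Rightarrow> complex^'n \<Rightarrow> (real \<Rightarrow> complex^'n) \<Rightarrow> bool" where
  "solves_linear_ode T A u0 u \<longleftrightarrow>
     u 0 = u0 \<and>
     (\<forall>t\<in>{0..T}. (u has_vector_derivative (A t *v u t)) (at t within {0..T}))"


section \<open>Tensor products\<close>

text \<open>
  Since the number of grid points is an ordinary natural number, $N \times N$ matrices are
  functions \<open>nat \<Rightarrow> nat \<Rightarrow> complex\<close> used only at indices below \<open>N\<close>, and an element
  $\sum_{l<N} |l\rangle \otimes w_l$ of $\mathbb{C}^N \otimes \mathbb{C}^n$ is the function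
  \<open>l \<mapsto> w l\<close>.  In particular $(\langle l| \otimes I_n)\, w$ is \<open>w l\<close>.
\<close>

definition ket :: "nat \<Rightarrow> nat \<Rightarrow> complex" where
  "ket k = (\<lambda>j. if j = k then 1 else 0)"

definition diag_mat :: "(nat \<Rightarrow> complex) \<Rightarrow> nat \<Rightarrow> nat \<Rightarrow> complex" where
  "diag_mat d = (\<lambda>j l. if j = l then d j else 0)"

definition id_mat :: "nat \<Rightarrow> nat \<Rightarrow> complex" where
  "id_mat = diag_mat (\<lambda>_. 1)"

text \<open>Some two-sided inverse, as for the library constant \<open>matrix_inv\<close>; its entries below \<open>N\<close> are determined
  as soon as one exists.\<close>

definition inv_mat :: "nat \<Rightarrow> (nat \<Rightarrow> nat \<Rightarrow> complex) \<Rightarrow> nat \<Rightarrow> nat \<Rightarrow> complex" where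
  "inv_mat N M = (SOME M'. \<forall>j<N. \<forall>l<N.
     (\<Sum>k<N. M j k * M' k l) = id_mat j l \<and> (\<Sum>k<N. M' j k * M k l) = id_mat j l)"

definition tensor_vec :: "(nat \<Rightarrow> complex) \<Rightarrow> complex^'n \<Rightarrow> nat \<Rightarrow> complex^'n" where
  "tensor_vec x v = (\<lambda>l. x l *s v)"

text \<open>The action of $M \otimes B$ on $\mathbb{C}^N \otimes \mathbb{C}^n$.\<close>

definition tensor_app ::
    "nat \<Rightarrow> (nat \<Rightarrow> nat \<Rightarrow> complex) \<Rightarrow> complex^'n^'n \<Rightarrow> (nat \<Rightarrow> complex^'n) \<Rightarrow> nat \<Rightarrow> complex^'n" where
  "tensor_app N M B w = (\<lambda>l. \<Sum>k<N. M l k *s (B *v w k))"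


section \<open>Fourier discretization in the auxiliary variable\<close>

definition mesh :: "real \<Rightarrow> nat \<Rightarrow> real" where
  "mesh L N = 2 * pi * L / real N"

definition grid :: "real \<Rightarrow> nat \<Rightarrow> nat \<Rightarrow> real" where
  "grid L N k = - pi * L + real k * mesh L N"

definition freq :: "real \<Rightarrow> nat \<Rightarrow> nat \<Rightarrow> real" where
  "freq L N l = (real l - real N / 2) / L"

definition mode :: "real \<Rightarrow> nat \<Rightarrow> nat \<Rightarrow> real \<Rightarrow> complex" where
  "mode L N l p = exp (\<i> * complex_of_real (freq L N l * (p + pi * L)))"

definition Phi :: "real \<Rightarrow> nat \<Rightarrow> nat \<Rightarrow> nat \<Rightarrow> complex" where
  "Phi L N = (\<lambda>j l. mode L N l (grid L N j))"

definition D_p :: "real \<Rightarrow> nat \<Rightarrow> nat \<Rightarrow> nat \<Rightarrow> complex" where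
  "D_p L N = diag_mat (\<lambda>l. complex_of_real (freq L N l))"

definition initial_grid_data :: "real \<Rightarrow> nat \<Rightarrow> complex^'n \<Rightarrow> nat \<Rightarrow> complex^'n" where
  "initial_grid_data L N u0 =
     (\<lambda>j. \<Sum>k<N. exp (- \<bar>grid L N k\<bar>) *\<^sub>R tensor_vec (ket k) u0 j)"

definition solves_schroedingerized ::
    "real \<Rightarrow> (real \<Rightarrow> complex^'n^'n) \<Rightarrow> complex^'n \<Rightarrow> real \<Rightarrow> nat \<Rightarrow>
     (real \<Rightarrow> nat \<Rightarrow> complex^'n) \<Rightarrow> bool" where
  "solves_schroedingerized T A u0 L N w \<longleftrightarrow>
     (\<forall>l<N. w 0 l = tensor_app N (inv_mat N (Phi L N)) (mat 1) (initial_grid_data L N u0) l) \<and>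
     (\<forall>l<N. \<forall>t\<in>{0..T}.
        ((\<lambda>s. w s l) has_vector_derivative
           (- \<i>) *s (tensor_app N (D_p L N) (herm1 (A t)) (w t) l
                     - tensor_app N id_mat (herm2 (A t)) (w t) l))
        (at t within {0..T}))"

text \<open>\<open>w_h L N w p\<close> and \<open>u_h L N w p\<close> are evaluated at the state \<open>w\<close> of the semi-discrete
  system at a single time.\<close>

definition w_h :: "real \<Rightarrow> nat \<Rightarrow> (nat \<Rightarrow> complex^'n) \<Rightarrow> real \<Rightarrow> complex^'n" where
  "w_h L N w p = (\<Sum>l<N. mode L N l p *s w l)"

definition u_h :: "real \<Rightarrow> nat \<Rightarrow> (nat \<Rightarrow> complex^'n) \<Rightarrow> real \<Rightarrow> complex^'n" where
  "u_h L N w p = exp p *\<^sub>R w_h L N w p"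

definition L2_norm_on :: "real set \<Rightarrow> (real \<Rightarrow> complex^'n) \<Rightarrow> real" where
  "L2_norm_on S f = sqrt (LINT p:S|lborel. (norm (f p))\<^sup>2)"

end

theory Submission
  imports Defs
begin

text \<open>
  For every \<open>p\<close>, not only on the grid, \<open>v t p = w_h L N (w t) p - exp (- p) *\<^sub>R u t\<close> solves the symmetric
  hyperbolic equation \<open>v\<^sub>t = i H\<^sub>2 v - H\<^sub>1 v\<^sub>p\<close> exactly, since both terms do. Its energy on an interval
  whose end points move with the speeds \<open>lam_plus\<close> and \<open>- lam_minus\<close> does not increase, so the error on
  \<open>(pd, pd + R)\<close> at time \<open>T\<close> is bounded by the \<open>L\<^sup>2\<close> norm at time \<open>0\<close> on \<open>[a, b]\<close> with
  \<open>a = pd - lam_plus * T \<ge> 0\<close> and \<open>b = pd + R + lam_minus * T\<close>. There \<open>v 0 p\<close> is the trigonometric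
  interpolation error of \<open>exp (- \<bar>p\<bar>)\<close>. If \<open>b \<le> pi * L\<close> it is of first order in the mesh size, by
  discrete Parseval on shifted grids, and \<open>u0\<close> is controlled by \<open>u T\<close>. Otherwise \<open>\<epsilon> \<ge> exp (- b)\<close>
  is bounded below by a constant and the stability of interpolation suffices.
\<close>

section \<open>Discrete Fourier analysis\<close>

lemma freq_mesh:
  assumes "L > 0" "N > 0"
  shows "freq L N l * mesh L N = 2 * pi * (real l - real N / 2) / real N"
  using assms by (simp add: freq_def mesh_def field_simps)

text \<open>The phase offset \<open>pi * L\<close> cancels the left end \<open>- pi * L\<close> of
  the grid. What remains is a power of one unimodular number times a phase that depends only on the
  translation.\<close>

lemma mode_grid_shift:
  "mode L N l (grid L N j + s)
     = cis (freq L N l * mesh L N) ^ j * cis (freq L N l * s)"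
  by (simp add: mode_def grid_def Complex.DeMoivre cis_mult cis_conv_exp algebra_simps flip: exp_of_nat_mult exp_add)

text \<open>This is a geometric sum whose ratio is an \<open>N\<close>-th root of unity. The ratio
  is not 1 because \<open>N\<close> cannot divide \<open>j - k\<close>. The factor \<open>m\<close>
  covers several periods at once.\<close>

lemma sum_root_of_unity:
  assumes "j < N" "k < N" "j \<noteq> k"
  shows "(\<Sum>l<m*N. cis (2 * pi * (real j - real k) / real N) ^ l) = 0"
proof -
  define \<omega> where "\<omega> = cis (2 * pi * (real j - real k) / real N)"
  have N: "N > 0" using assms by simp
  have "\<omega> \<noteq> 1"
  proof
    assume "\<omega> = 1"
    then obtain n :: int where "2 * pi * (real j - real k) / real N = of_int (2 * n) * pi"
      unfolding \<omega>_def cis_conv_exp exp_eq_1 by auto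
    then have "pi * (2 * (real j - real k)) = pi * (2 * (of_int n * real N))"
      using N by (simp add: field_simps)
    then have "real j - real k = of_int n * real N"
      by simp
    then have "of_int (int j - int k) = (of_int (n * int N) :: real)"
      by simp
    then have eq: "int j - int k = n * int N"
      by (simp only: of_int_eq_iff)
    then have "\<bar>n * int N\<bar> < int N" using assms by linarith
    then have "\<bar>n\<bar> * int N < 1 * int N" by (simp add: abs_mult)
    then have "n = 0" using N by (simp only: mult_less_cancel_right) auto
    then show False using eq assms by simp
  qed
  moreover have "\<omega> ^ (m * N) = 1"
  proof -
    have "real N * (2 * pi * (real j - real k) / real N) = 2 * pi * of_int (int j - int k)"
      using N by simp
    then have "\<omega> ^ N = cis (2 * pi * of_int (int j - int k))"
      unfolding \<omega>_def Complex.DeMoivre by (simp only:)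
    also have "\<dots> = 1" by (rule cis_multiple_2pi) auto
    finally show ?thesis by (simp add: mult.commute[of m] power_mult)
  qed
  ultimately show ?thesis
    unfolding \<omega>_def[symmetric] by (simp add: geometric_sum)
qed

lemma Phi_altdef: "Phi L N j l = cis (freq L N l * mesh L N) ^ j"
  using mode_grid_shift[of L N l j 0] by (simp add: Phi_def)

lemma Phi_orthogonal_columns:
  assumes "L > 0" "N > 0" "l < N" "k < N"
  shows "(\<Sum>j<m*N. Phi L N j l * cnj (Phi L N j k)) = (if l = k then of_nat (m * N) else 0)"
proof -
  have "Phi L N j l * cnj (Phi L N j k) = cis (2 * pi * (real l - real k) / real N) ^ j" for j
  proof -
    have "real j * (freq L N l * mesh L N) + - (real j * (freq L N k * mesh L N))
        = real j * (2 * pi * (real l - real k) / real N)"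
      using assms unfolding freq_mesh[OF assms(1,2)] by (simp add: field_simps)
    then show ?thesis
      unfolding Phi_altdef Complex.DeMoivre cis_cnj cis_mult by (simp only:)
  qed
  then show ?thesis
    using sum_root_of_unity[OF assms(3,4)] by simp
qed

lemma Phi_orthogonal_rows:
  assumes "L > 0" "N > 0" "j < N" "k < N"
  shows "(\<Sum>l<N. Phi L N j l * cnj (Phi L N k l)) = (if j = k then of_nat N else 0)"
proof -
  \<comment> \<open>The frequencies are centred by \<open>N / 2\<close>; this produces the
    prefactor, which does not depend on \<open>l\<close> and leaves the sum.\<close>
  have "Phi L N j l * cnj (Phi L N k l)
      = cis (pi * (real k - real j)) * cis (2 * pi * (real j - real k) / real N) ^ l" for l
  proof -
    have "real j * (freq L N l * mesh L N) + - (real k * (freq L N l * mesh L N))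
        = pi * (real k - real j) + real l * (2 * pi * (real j - real k) / real N)"
      using assms unfolding freq_mesh[OF assms(1,2)] by (simp add: field_simps)
    then show ?thesis
      unfolding Phi_altdef Complex.DeMoivre cis_cnj cis_mult by (simp only:)
  qed
  then show ?thesis
    using sum_root_of_unity[OF assms(3,4), of 1] by (simp flip: sum_distrib_left)
qed

lemma inv_mat_Phi:
  assumes "L > 0" "N > 0" "j < N" "l < N"
  shows "(\<Sum>k<N. Phi L N j k * inv_mat N (Phi L N) k l) = id_mat j l"
proof -
  let ?P = "\<lambda>M'. \<forall>j<N. \<forall>l<N. (\<Sum>k<N. Phi L N j k * M' k l) = id_mat j l
       \<and> (\<Sum>k<N. M' j k * Phi L N k l) = id_mat j l"
  \<comment> \<open>By orthogonality the conjugate transpose divided by \<open>N\<close> is a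
    two-sided inverse, which justifies the choice made in \<open>inv_mat\<close>.\<close>
  have "?P (\<lambda>k j. cnj (Phi L N j k) / of_nat N)"
    using Phi_orthogonal_rows[OF assms(1,2)] Phi_orthogonal_columns[OF assms(1,2), where m=1] assms(2)
    by (auto simp: id_mat_def diag_mat_def mult.commute[of "cnj _"] simp flip: sum_divide_distrib)
  then have "?P (inv_mat N (Phi L N))"
    unfolding inv_mat_def by (rule someI[where P = ?P])
  then show ?thesis using assms by blast
qed

text \<open>Expanding the square leaves only diagonal terms, by orthogonality of the columns over
  \<open>m\<close> periods.\<close>

lemma Parseval_Phi:
  assumes "L > 0" "N > 0"
  shows "(\<Sum>j<m*N. (cmod (\<Sum>l<N. d l * Phi L N j l))\<^sup>2) = real (m * N) * (\<Sum>l<N. (cmod (d l))\<^sup>2)"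
proof -
  have "complex_of_real (\<Sum>j<m*N. (cmod (\<Sum>l<N. d l * Phi L N j l))\<^sup>2)
    = (\<Sum>j<m*N. \<Sum>l<N. \<Sum>k<N. d l * cnj (d k) * (Phi L N j l * cnj (Phi L N j k)))"
    unfolding complex_norm_square of_real_sum cnj_sum complex_cnj_mult sum_product
    by (intro sum.cong refl) (simp only: mult_ac)
  also have "\<dots> = (\<Sum>l<N. \<Sum>k<N. d l * cnj (d k) * (\<Sum>j<m*N. Phi L N j l * cnj (Phi L N j k)))"
    by (subst sum.swap, rule sum.cong, simp, subst sum.swap, simp only: sum_distrib_left)
  also have "\<dots> = (\<Sum>l<N. \<Sum>k<N. d l * cnj (d k) * (if l = k then of_nat (m * N) else 0))"
    using Phi_orthogonal_columns[OF assms] by (intro sum.cong refl) auto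
  also have "\<dots> = complex_of_real (real (m * N) * (\<Sum>l<N. (cmod (d l))\<^sup>2))"
    by (simp only: complex_norm_square of_real_sum of_real_mult of_real_of_nat_eq sum_distrib_left)
       (simp add: if_distrib mult_ac cong: if_cong)
  finally show ?thesis by (simp only: of_real_eq_iff)
qed

section \<open>Trigonometric polynomials on translates of the grid\<close>

definition trig_poly :: "real \<Rightarrow> nat \<Rightarrow> (nat \<Rightarrow> complex) \<Rightarrow> real \<Rightarrow> complex" where
  "trig_poly L N c p = (\<Sum>l<N. c l * mode L N l p)"

lemma continuous_on_trig_poly: "continuous_on S (trig_poly L N c)"
  unfolding trig_poly_def mode_def by (intro continuous_intros)

lemma trig_poly_grid_shift:
  "trig_poly L N c (grid L N j + s) = (\<Sum>l<N. (c l * cis (freq L N l * s)) * Phi L N j l)"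
  unfolding trig_poly_def mode_grid_shift Phi_altdef by (simp add: mult_ac)

lemma trig_poly_grid: "trig_poly L N c (grid L N j) = (\<Sum>l<N. c l * Phi L N j l)"
  using trig_poly_grid_shift[of L N c j 0] by simp

text \<open>For even \<open>N\<close> every \<open>freq L N l * L\<close> is an integer, so the
  modes have period \<open>2 * pi * L\<close>. This serves the right end of the last cell, which is
  not an interpolation node.\<close>

lemma trig_poly_periodic_grid:
  assumes "L > 0" "N > 0" "even N"
  shows "trig_poly L N c (grid L N N) = trig_poly L N c (grid L N 0)"
proof -
  obtain M where M: "N = 2 * M" using assms by auto
  have "Phi L N N l = 1" for l
  proof -
    have "real N * (freq L N l * mesh L N) = 2 * pi * of_int (int l - int M)"
      using assms by (simp add: freq_mesh M)
    moreover have "cis (2 * pi * of_int (int l - int M)) = 1"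
      by (rule cis_multiple_2pi) auto
    ultimately show ?thesis unfolding Phi_altdef Complex.DeMoivre by (simp only:)
  qed
  then show ?thesis by (simp add: trig_poly_grid) (simp add: Phi_altdef)
qed

text \<open>A translation by \<open>s\<close> multiplies the coefficients by unimodular factors,
  which Parseval does not see.\<close>

lemma sum_norm_trig_poly_grid_shift:
  assumes "L > 0" "N > 0"
  shows "(\<Sum>j<m*N. (cmod (trig_poly L N c (grid L N j + s)))\<^sup>2)
       = real m * (\<Sum>j<N. (cmod (trig_poly L N c (grid L N j)))\<^sup>2)"
  unfolding trig_poly_grid_shift trig_poly_grid Parseval_Phi[OF assms]
  using Parseval_Phi[OF assms, of c 1] by (simp add: norm_mult)

lemma norm_cis_minus_one: "cmod (cis x - 1) = 2 * \<bar>sin (x / 2)\<bar>"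
proof -
  have "cis x - 1 = cis (x/2) * (2 * \<i> * sin (x/2))"
    using sin_squared_eq[of "x/2"]
    by (auto simp: complex_eq_iff cos_double_sin[of "x/2", simplified] sin_double[of "x/2", simplified] power2_eq_square)
  then show ?thesis by (simp add: norm_mult)
qed

text \<open>The half angles have absolute value at most \<open>pi / 2\<close>, where the sine is
  increasing.\<close>

lemma norm_cis_minus_one_mono:
  assumes "\<bar>x\<bar> \<le> \<bar>y\<bar>" "\<bar>y\<bar> \<le> pi"
  shows "cmod (cis x - 1) \<le> cmod (cis y - 1)"
proof -
  have *: "\<bar>sin (z/2)\<bar> = sin (\<bar>z\<bar>/2)" if "\<bar>z\<bar> \<le> pi" for z :: real
    using that sin_ge_zero[of "\<bar>z\<bar>/2"] by (cases "z \<ge> 0") auto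
  have "sin (\<bar>x\<bar>/2) \<le> sin (\<bar>y\<bar>/2)"
    using assms by (intro sin_monotone_2pi_le) auto
  then show ?thesis
    using assms by (simp add: norm_cis_minus_one *)
qed

text \<open>All frequencies satisfy \<open>\<bar>freq * mesh\<bar> \<le> pi\<close>, so that the increment of a mode over a fraction of
  a cell is dominated by its increment over the whole cell.\<close>

lemma sum_increment_trig_poly_le:
  assumes "L > 0" "N > 0" "0 \<le> s" "s \<le> mesh L N"
  shows "(\<Sum>j<N. (cmod (trig_poly L N c (grid L N j + s) - trig_poly L N c (grid L N j)))\<^sup>2)
       \<le> (\<Sum>j<N. (cmod (trig_poly L N c (grid L N (Suc j)) - trig_poly L N c (grid L N j)))\<^sup>2)"
proof -
  \<comment> \<open>Parseval turns both sides into coefficient sums, so that the increments can be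
    compared frequency by frequency.\<close>
  have P: "(\<Sum>j<N. (cmod (trig_poly L N c (grid L N j + x) - trig_poly L N c (grid L N j)))\<^sup>2)
     = real N * (\<Sum>l<N. (cmod (c l * (cis (freq L N l * x) - 1)))\<^sup>2)" for x
    unfolding trig_poly_grid_shift trig_poly_grid sum_subtractf[symmetric]
    using Parseval_Phi[OF assms(1,2), of "\<lambda>l. c l * (cis (freq L N l * x) - 1)" 1]
    by (simp add: algebra_simps)
  have S: "grid L N (Suc j) = grid L N j + mesh L N" for j
    by (simp add: grid_def algebra_simps)
  have "cmod (cis (freq L N l * s) - 1) \<le> cmod (cis (freq L N l * mesh L N) - 1)" if "l < N" for l
  proof (rule norm_cis_minus_one_mono)
    show "\<bar>freq L N l * s\<bar> \<le> \<bar>freq L N l * mesh L N\<bar>"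
      using assms by (simp add: abs_mult mult_left_mono)
    have "2 * pi * (real l - real N / 2) / real N = pi * ((2 * real l - real N) / real N)"
      using assms by (simp add: field_simps)
    then have "\<bar>2 * pi * (real l - real N / 2) / real N\<bar> = \<bar>pi * ((2 * real l - real N) / real N)\<bar>"
      by (simp only:)
    also have "\<dots> = pi * (\<bar>2 * real l - real N\<bar> / real N)"
      by (simp add: abs_mult)
    also have "\<bar>2 * real l - real N\<bar> / real N \<le> 1"
      using that by (simp add: field_simps)
    finally show "\<bar>freq L N l * mesh L N\<bar> \<le> pi"
      using assms by (simp add: freq_mesh)
  qed
  then show ?thesis
    unfolding S P by (intro mult_left_mono sum_mono power_mono) (auto simp: norm_mult mult_left_mono)
qed

section \<open>Interpolation of the kink\<close>

lemma integral_cells: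
  fixes f :: "real \<Rightarrow> real"
  assumes "h \<ge> 0" "continuous_on {x..x + real n * h} f"
  shows "integral {x..x + real n * h} f = (\<Sum>j<n. integral {0..h} (\<lambda>s. f (x + real j * h + s)))"
  using assms(2)
proof (induction n)
  case (Suc n)
  have le: "x \<le> x + real n * h" "x + real n * h \<le> x + real (Suc n) * h"
    using assms(1) by (auto simp: algebra_simps)
  have "integral {0..h} (\<lambda>s. f (x + real n * h + s)) = integral {0..h} (f \<circ> (\<lambda>s. s + (x + real n * h)))"
    by (simp add: o_def add_ac)
  also have "\<dots> = integral {x + real n * h..x + real (Suc n) * h} f"
    using integral_shift[of 0 "x + real n * h" h f] le
      continuous_on_subset[OF Suc.prems, of "{x + real n * h..x + real (Suc n) * h}"]
    by (simp add: algebra_simps)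
  moreover have "integral {x..x + real n * h} f = (\<Sum>j<n. integral {0..h} (\<lambda>s. f (x + real j * h + s)))"
    using le by (intro Suc.IH continuous_on_subset[OF Suc.prems]) auto
  ultimately show ?case
    using Henstock_Kurzweil_Integration.integral_combine[OF le integrable_continuous_interval[OF Suc.prems]]
    by simp
qed auto

lemma grid_0: "grid L N 0 = - pi * L"
  and grid_Suc: "grid L N (Suc j) = grid L N j + mesh L N"
  and grid_last: "N > 0 \<Longrightarrow> grid L N N = pi * L"
  and mesh_nonneg: "L \<ge> 0 \<Longrightarrow> mesh L N \<ge> 0"
  and mesh_times: "N > 0 \<Longrightarrow> real N * mesh L N = 2 * pi * L"
  by (auto simp: grid_def mesh_def algebra_simps add_divide_distrib)

text \<open>This is the stability of interpolation in the mean-square norm: for each offset within a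
  cell the grid sum of squares equals the one at the nodes, where the values are at most 1.\<close>

lemma integral_trig_poly_periods_le:
  assumes "L > 0" "N > 0" "\<And>j. j < N \<Longrightarrow> cmod (trig_poly L N c (grid L N j)) \<le> 1"
  shows "integral {- pi * L..- pi * L + real m * (2 * pi * L)} (\<lambda>p. (cmod (trig_poly L N c p))\<^sup>2)
       \<le> real m * (2 * pi * L)"
proof -
  let ?h = "mesh L N" and ?f = "\<lambda>p. (cmod (trig_poly L N c p))\<^sup>2"
  have cont: "continuous_on S ?f" for S
    by (intro continuous_intros continuous_on_trig_poly)
  have h: "?h \<ge> 0" "real m * (2 * pi * L) = real (m * N) * ?h"
    using assms mesh_nonneg[of L N] mesh_times[of N L] by auto
  have "integral {- pi * L..- pi * L + real m * (2 * pi * L)} ?f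
      = (\<Sum>j<m*N. integral {0..?h} (\<lambda>s. ?f (grid L N j + s)))"
    unfolding h(2) by (subst integral_cells[OF h(1) cont]) (simp add: grid_def)
  also have "\<dots> = integral {0..?h} (\<lambda>s. \<Sum>j<m*N. ?f (grid L N j + s))"
    by (intro Henstock_Kurzweil_Integration.integral_sum[symmetric] integrable_continuous_interval
        continuous_on_compose2[OF cont[of UNIV]] continuous_intros) auto
  also have "\<dots> = ?h * (real m * (\<Sum>j<N. ?f (grid L N j)))"
    using h(1) by (simp add: sum_norm_trig_poly_grid_shift[OF assms(1,2)])
  also have "\<dots> \<le> ?h * (real m * (\<Sum>j<N. 1))"
    using assms(3) h(1) by (intro mult_left_mono sum_mono) (auto simp: power_le_one)
  also have "\<dots> = real m * (2 * pi * L)"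
    using h(2) by (auto simp: mult_ac)
  finally show ?thesis .
qed

text \<open>The variation function of \<open>exp (- \<bar>p\<bar>)\<close>; its increments dominate those of \<open>exp (- \<bar>p\<bar>)\<close> and telescope.\<close>

definition kink_variation :: "real \<Rightarrow> real" where
  "kink_variation x = (if x \<le> 0 then exp x else 2 - exp (- x))"

lemma kink_variation_bounds: "0 < kink_variation x" "kink_variation x < 2"
proof -
  have "exp x < 2" if "x \<le> 0" using that by (intro le_less_trans[of "exp x" 1]) auto
  moreover have "exp (-x) < 2" if "x > 0" using that by (intro le_less_trans[of "exp (-x)" 1]) auto
  ultimately show "0 < kink_variation x" "kink_variation x < 2"
    by (auto simp: kink_variation_def not_le)
qed

text \<open>The tangent of the exponential at \<open>y\<close> lies below the graph, and its slope
  is at most 1 because \<open>y \<le> 0\<close>.\<close>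

lemma exp_diff_le:
  fixes x y :: real
  assumes "x \<le> y" "y \<le> 0"
  shows "exp y - exp x \<le> y - x"
proof -
  have "exp y * (1 + (x - y)) \<le> exp y * exp (x - y)"
    by (intro mult_left_mono exp_ge_add_one_self) auto
  then have "exp y - exp x \<le> exp y * (y - x)"
    by (simp add: algebra_simps flip: exp_add)
  also have "\<dots> \<le> 1 * (y - x)"
    using assms by (intro mult_right_mono) auto
  finally show ?thesis by simp
qed

lemma kink_variation_diff_le:
  assumes "x \<le> y"
  shows "kink_variation y - kink_variation x \<le> y - x"
proof -
  consider "y \<le> 0" | "x \<le> 0" "y > 0" | "x > 0" by linarith
  then show ?thesis
  proof cases
    case 1 then show ?thesis using assms exp_diff_le[of x y] by (simp add: kink_variation_def)
  next
    \<comment> \<open>The interval is split at the kink; by reflection both pieces become increments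
      of the exponential on the negative axis.\<close>
    case 2 then show ?thesis using exp_diff_le[of x 0] exp_diff_le[of "-y" 0] by (simp add: kink_variation_def)
  next
    case 3 then show ?thesis using assms exp_diff_le[of "-y" "-x"] by (simp add: kink_variation_def)
  qed
qed

lemma exp_abs_diff_le_kink_variation:
  assumes "x \<le> y"
  shows "\<bar>exp (- \<bar>y\<bar>) - exp (- \<bar>x\<bar>)\<bar> \<le> kink_variation y - kink_variation x"
proof -
  consider "y \<le> 0" | "x \<le> 0" "y > 0" | "x > 0" by linarith
  then show ?thesis
  proof cases
    \<comment> \<open>Across the kink the variation increases by
      \<open>(1 - exp x) + (1 - exp (- y))\<close>. Both terms are nonnegative, and their difference
      is the increment of the function.\<close>
    case 2
    then have "exp x \<le> 1" "exp (-y) \<le> 1" by auto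
    then show ?thesis using 2 by (simp add: kink_variation_def abs_le_iff)
  qed (use assms in \<open>auto simp: kink_variation_def abs_le_iff\<close>)
qed

lemma kink_variation_mono: "x \<le> y \<Longrightarrow> kink_variation x \<le> kink_variation y"
  using exp_abs_diff_le_kink_variation[of x y] by linarith

text \<open>One factor of each square is at most the mesh size, and the other telescopes to a total
  below 2. Hence neither the number of cells nor the length of the period enters separately.\<close>

lemma sum_square_increments_kink_variation:
  assumes "L > 0"
  shows "(\<Sum>j<N. (kink_variation (grid L N (Suc j)) - kink_variation (grid L N j))\<^sup>2) \<le> 2 * mesh L N"
proof -
  let ?G = "\<lambda>j. kink_variation (grid L N j)"
  have h: "mesh L N \<ge> 0" using assms mesh_nonneg[of L N] by simp
  have le: "grid L N j \<le> grid L N (Suc j)" for j using h by (simp add: grid_Suc)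
  have "(\<Sum>j<N. (?G (Suc j) - ?G j)\<^sup>2) \<le> (\<Sum>j<N. mesh L N * (?G (Suc j) - ?G j))"
    unfolding power2_eq_square
    using kink_variation_diff_le[OF le] kink_variation_mono[OF le]
    by (intro sum_mono mult_right_mono) (auto simp: grid_Suc)
  also have "\<dots> = mesh L N * (?G N - ?G 0)"
    using sum_lessThan_telescope[of ?G N] by (simp flip: sum_distrib_left)
  also have "\<dots> \<le> mesh L N * 2"
    using h kink_variation_bounds(2)[of "grid L N N"] kink_variation_bounds(1)[of "grid L N 0"]
    by (intro mult_left_mono) auto
  finally show ?thesis by simp
qed

lemma square_sum_le: "(a + b)\<^sup>2 \<le> 2 * a\<^sup>2 + 2 * (b::real)\<^sup>2"
  using zero_le_power2[of "a - b"] by (simp add: power2_eq_square algebra_simps)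

text \<open>On each cell both the interpolant and the function are compared with their common value at
  the left grid point.\<close>

lemma integral_interpolation_error_le:
  assumes "L > 0" "N > 0" "even N"
    and interp: "\<And>j. j < N \<Longrightarrow> trig_poly L N c (grid L N j) = exp (- \<bar>grid L N j\<bar>)"
  shows "integral {- pi * L..pi * L} (\<lambda>p. (cmod (trig_poly L N c p - exp (- \<bar>p\<bar>)))\<^sup>2) \<le> 8 * (mesh L N)\<^sup>2"
proof -
  let ?h = "mesh L N" and ?I = "trig_poly L N c" and ?g = "\<lambda>p::real. exp (- \<bar>p\<bar>)" and ?x = "grid L N"
  let ?f = "\<lambda>p. (cmod (?I p - ?g p))\<^sup>2"
  let ?D = "\<lambda>j. kink_variation (?x (Suc j)) - kink_variation (?x j)"
  have cont: "continuous_on S ?f" for S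
    by (intro continuous_intros continuous_on_trig_poly)
  have h: "?h \<ge> 0" "pi * L = - pi * L + real N * ?h"
    using assms mesh_nonneg[of L N] mesh_times[of N L] by auto
  \<comment> \<open>At \<open>j = N\<close> this follows by periodicity, since \<open>?g\<close>
    takes the same value at both ends of the period.\<close>
  have interp': "?I (?x j) = ?g (?x j)" if "j \<le> N" for j
    using that interp[of j] interp[of 0] trig_poly_periodic_grid[OF assms(1,2,3), of c] assms(2)
    by (cases "j = N") (auto simp: grid_0 grid_last abs_mult)
  \<comment> \<open>Each of the two comparisons on a cell contributes twice the sum of the squared
    \<open>?D j\<close>, hence the constant 4.\<close>
  have pointwise: "(\<Sum>j<N. ?f (?x j + s)) \<le> 4 * (\<Sum>j<N. (?D j)\<^sup>2)" if s: "0 \<le> s" "s \<le> ?h" for s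
  proof -
    have "?f (?x j + s) \<le> 2 * (cmod (?I (?x j + s) - ?I (?x j)))\<^sup>2 + 2 * (?D j)\<^sup>2" if "j < N" for j
    proof -
      have "\<bar>?g (?x j + s) - ?g (?x j)\<bar> \<le> kink_variation (?x j + s) - kink_variation (?x j)"
        using s by (intro exp_abs_diff_le_kink_variation) auto
      also have "\<dots> \<le> ?D j"
        using s by (simp add: grid_Suc kink_variation_mono)
      finally have *: "\<bar>?g (?x j) - ?g (?x j + s)\<bar> \<le> ?D j" by linarith
      have "cmod (complex_of_real (?g (?x j)) - ?g (?x j + s)) = \<bar>?g (?x j) - ?g (?x j + s)\<bar>"
        by (metis norm_of_real of_real_diff)
      then have "cmod (?I (?x j + s) - ?g (?x j + s)) \<le> cmod (?I (?x j + s) - ?I (?x j)) + ?D j"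
        using norm_triangle_ineq[of "?I (?x j + s) - ?I (?x j)" "?g (?x j) - ?g (?x j + s)"] *
          interp'[of j] that by (simp add: algebra_simps)
      then have "?f (?x j + s) \<le> (cmod (?I (?x j + s) - ?I (?x j)) + ?D j)\<^sup>2"
        by (intro power_mono) auto
      also have "\<dots> \<le> 2 * (cmod (?I (?x j + s) - ?I (?x j)))\<^sup>2 + 2 * (?D j)\<^sup>2"
        by (rule square_sum_le)
      finally show ?thesis .
    qed
    then have "(\<Sum>j<N. ?f (?x j + s))
        \<le> 2 * (\<Sum>j<N. (cmod (?I (?x j + s) - ?I (?x j)))\<^sup>2) + 2 * (\<Sum>j<N. (?D j)\<^sup>2)"
      unfolding sum_distrib_left sum.distrib[symmetric] by (intro sum_mono) auto
    \<comment> \<open>The increment of the interpolant over part of a cell is first replaced by the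
      one between nodes. There the interpolant agrees with \<open>?g\<close>, whose increments are
      dominated by \<open>?D\<close>.\<close>
    also have "(\<Sum>j<N. (cmod (?I (?x j + s) - ?I (?x j)))\<^sup>2) \<le> (\<Sum>j<N. (cmod (?I (?x (Suc j)) - ?I (?x j)))\<^sup>2)"
      using s by (intro sum_increment_trig_poly_le assms) auto
    also have "\<dots> \<le> (\<Sum>j<N. (?D j)\<^sup>2)"
    proof (intro sum_mono power_mono)
      fix j assume "j \<in> {..<N}"
      then have "cmod (?I (?x (Suc j)) - ?I (?x j)) = \<bar>?g (?x (Suc j)) - ?g (?x j)\<bar>"
        using interp'[of j] interp'[of "Suc j"] by (metis Suc_leI lessThan_iff less_imp_le norm_of_real of_real_diff)
      also have "\<dots> \<le> ?D j"
        using h by (intro exp_abs_diff_le_kink_variation) (auto simp: grid_Suc)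
      finally show "cmod (?I (?x (Suc j)) - ?I (?x j)) \<le> ?D j" .
    qed auto
    finally show ?thesis by simp
  qed
  have "integral {- pi * L..pi * L} ?f = (\<Sum>j<N. integral {0..?h} (\<lambda>s. ?f (?x j + s)))"
    by (subst h(2), subst integral_cells[OF h(1) cont]) (simp add: grid_def)
  also have "\<dots> = integral {0..?h} (\<lambda>s. \<Sum>j<N. ?f (?x j + s))"
    by (intro Henstock_Kurzweil_Integration.integral_sum[symmetric] integrable_continuous_interval
        continuous_on_compose2[OF cont[of UNIV]] continuous_intros) auto
  also have "\<dots> \<le> integral {0..?h} (\<lambda>s. 4 * (\<Sum>j<N. (?D j)\<^sup>2))"
    by (intro integral_le integrable_continuous_interval pointwise continuous_on_sum
        continuous_on_compose2[OF cont[of UNIV]] continuous_intros) auto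
  also have "\<dots> = 4 * ?h * (\<Sum>j<N. (?D j)\<^sup>2)"
    using h(1) by simp
  also have "\<dots> \<le> 4 * ?h * (2 * ?h)"
    using h(1) sum_square_increments_kink_variation[OF assms(1), of N] by (intro mult_left_mono) auto
  finally show ?thesis by (simp add: power2_eq_square)
qed

section \<open>Numerical range of the Hermitian part\<close>

text \<open>Moving from \<open>x\<close> in the direction \<open>- q x\<close> changes the form to
  first order by a negative multiple of the squared norm of \<open>q x\<close>. If
  \<open>q x\<close> were nonzero, the form would become negative.\<close>

lemma psd_kernel:
  fixes q :: "'v::real_inner \<Rightarrow> 'v"
  assumes lin: "linear q" and sa: "\<And>x y. x \<bullet> q y = q x \<bullet> y"
    and psd: "\<And>y. y \<bullet> q y \<ge> 0" and zero: "x \<bullet> q x = 0"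
  shows "q x = 0"
proof (rule ccontr)
  assume nz: "q x \<noteq> 0"
  define a b where "a = q x \<bullet> q x" and "b = q x \<bullet> q (q x)"
  have a: "a > 0" using nz by (simp add: a_def)
  have b: "b \<ge> 0" using psd by (simp add: b_def)
  have *: "0 \<le> - 2 * s * a + s\<^sup>2 * b" for s
  proof -
    have "x \<bullet> q (q x) = a" by (simp add: sa a_def)
    then have "(x - s *\<^sub>R q x) \<bullet> q (x - s *\<^sub>R q x) = - 2 * s * a + s\<^sup>2 * b"
      using zero by (simp add: linear_diff[OF lin] linear_scale[OF lin] inner_diff a_def b_def
          power2_eq_square algebra_simps)
    then show ?thesis using psd by metis
  qed
  \<comment> \<open>A step length that makes the quadratic in \<open>s\<close> negative; the added 1
    covers the case \<open>b = 0\<close>.\<close>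
  define r where "r = a / (b + 1)"
  have r: "a = r * (b + 1)" "r > 0" using a b by (auto simp: r_def)
  have "0 \<le> - 2 * r * a + r\<^sup>2 * b" by (rule *)
  also have "\<dots> = - (r\<^sup>2 * (b + 2))"
    by (simp add: r(1) power2_eq_square algebra_simps)
  also have "\<dots> < 0"
    using r(2) b by simp
  finally show False by simp
qed

text \<open>A maximizer \<open>v\<close> on the unit sphere exists by compactness. In place of
  Lagrange multipliers, \<open>M *\<^sub>R x - H x\<close> defines a positive semidefinite form that
  vanishes at \<open>v\<close>, so \<open>v\<close> lies in its kernel.\<close>

lemma rayleigh_max:
  fixes H :: "'v::euclidean_space \<Rightarrow> 'v"
  assumes lin: "linear H" and sa: "\<And>x y. x \<bullet> H y = H x \<bullet> y"
  obtains M v where "v \<noteq> 0" "H v = M *\<^sub>R v" "\<And>x. x \<bullet> H x \<le> M * (norm x)\<^sup>2"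
proof -
  have "continuous_on (sphere 0 1) (\<lambda>x. x \<bullet> H x)"
    using lin by (intro continuous_intros linear_continuous_on) (simp add: linear_conv_bounded_linear)
  moreover have "sphere (0::'v) 1 \<noteq> {}" by simp
  ultimately obtain v where v: "norm v = 1" and max: "\<And>y. norm y = 1 \<Longrightarrow> y \<bullet> H y \<le> v \<bullet> H v"
    using continuous_attains_sup[of "sphere (0::'v) 1" "\<lambda>x. x \<bullet> H x"] by (auto simp: dist_norm)
  define M where "M = v \<bullet> H v"
  have le: "x \<bullet> H x \<le> M * (norm x)\<^sup>2" for x
  proof (cases "x = 0")
    case False
    define y where "y = x /\<^sub>R norm x"
    have "x = norm x *\<^sub>R y" "norm y = 1" using False by (auto simp: y_def)
    then have "x \<bullet> H x = (norm x)\<^sup>2 * (y \<bullet> H y)"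
      by (metis linear_scale[OF lin] inner_scaleR_left inner_scaleR_right mult.assoc power2_eq_square)
    then show ?thesis
      using max[OF \<open>norm y = 1\<close>] by (simp add: M_def mult.commute mult_right_mono)
  qed (simp add: linear_0[OF lin])
  have "M *\<^sub>R v - H v = 0"
  proof (rule psd_kernel[where q = "\<lambda>x. M *\<^sub>R x - H x"])
    show "linear (\<lambda>x. M *\<^sub>R x - H x)"
      using lin by (auto intro!: linearI simp: linear_add linear_scale algebra_simps)
    show "x \<bullet> (M *\<^sub>R y - H y) = (M *\<^sub>R x - H x) \<bullet> y" for x y
      by (simp add: inner_diff sa)
    show "0 \<le> y \<bullet> (M *\<^sub>R y - H y)" for y
      using le[of y] by (simp add: inner_diff power2_norm_eq_inner)
    show "v \<bullet> (M *\<^sub>R v - H v) = 0"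
      using v by (simp add: inner_diff M_def flip: power2_norm_eq_inner)
  qed
  then show ?thesis using le v by (intro that[of v M]) auto
qed

text \<open>The inner product on \<open>complex^'n\<close> is the real part of the Hermitian one, so
  the conjugate transpose is also the adjoint over the reals.\<close>

lemma inner_conj_transpose:
  "x \<bullet> (M *v y) = (conj_transpose M *v x) \<bullet> y"
proof -
  have i: "a \<bullet> b = Re (cnj a * b)" for a b :: complex by (simp add: inner_complex_def)
  have "x \<bullet> (M *v y) = (\<Sum>i\<in>UNIV. \<Sum>j\<in>UNIV. Re (cnj (x $ i) * (M $ i $ j * y $ j)))"
    by (simp only: inner_vec_def matrix_vector_mult_def vec_lambda_beta i sum_distrib_left Re_sum)
  also have "\<dots> = (\<Sum>j\<in>UNIV. \<Sum>i\<in>UNIV. Re (cnj (x $ i) * (M $ i $ j * y $ j)))"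
    by (rule sum.swap)
  also have "\<dots> = (conj_transpose M *v x) \<bullet> y"
    by (simp only: inner_vec_def matrix_vector_mult_def vec_lambda_beta i sum_distrib_right Re_sum
        conj_transpose_def cnj_sum complex_cnj_mult complex_cnj_cnj) (simp only: mult_ac)
  finally show ?thesis .
qed

lemma conj_transpose_herm1: "conj_transpose (herm1 M) = herm1 M"
  by (simp add: conj_transpose_def herm1_def vec_eq_iff add.commute)

lemma inner_herm1: "x \<bullet> (herm1 M *v y) = (herm1 M *v x) \<bullet> y"
  using inner_conj_transpose[of x "herm1 M" y] by (simp add: conj_transpose_herm1)

text \<open>This eliminates \<open>herm2\<close>: multiplied by \<open>\<i>\<close> it is the
  skew-Hermitian part of \<open>M\<close>.\<close>

lemma ii_herm2: "\<i> *s (herm2 M *v x) = (M - herm1 M) *v x"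
proof -
  have "\<i> * herm2 M $ i $ j = (M - herm1 M) $ i $ j" for i j
    by (simp add: herm2_def herm1_def conj_transpose_def field_simps)
  then have "\<i> * (herm2 M $ i $ j * x $ j) = (M - herm1 M) $ i $ j * x $ j" for i j
    by (metis mult.assoc)
  then show ?thesis
    by (simp only: vec_eq_iff matrix_vector_mult_def vec_lambda_beta vector_scalar_mult_def sum_distrib_left) simp
qed

lemma inner_skew_part: "x \<bullet> ((M - herm1 M) *v x) = 0"
proof -
  have "conj_transpose (M - herm1 M) = - (M - herm1 M)"
    by (simp add: conj_transpose_def herm1_def vec_eq_iff field_simps)
  then have "x \<bullet> ((M - herm1 M) *v x) = (- (M - herm1 M) *v x) \<bullet> x"
    using inner_conj_transpose[of x "M - herm1 M" x] by simp
  also have "- (M - herm1 M) *v x = - ((M - herm1 M) *v x)"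
    by (simp only: vec_eq_iff matrix_vector_mult_def vec_lambda_beta vector_uminus_component mult_minus_left sum_negf) simp
  finally show ?thesis by (simp add: inner_commute)
qed

lemma linear_matrix_vector_complex: "linear (\<lambda>x. (M :: complex^'n^'m) *v x)"
  by (intro linearI) (auto simp: vec_eq_iff matrix_vector_mult_def algebra_simps sum.distrib scaleR_sum_right)

lemma scaleR_conv_scalar_mult: "c *\<^sub>R (x :: complex^'n) = complex_of_real c *s x"
  by (simp only: vec_eq_iff vector_scaleR_component vector_smult_component scaleR_conv_of_real[where 'a=complex]) simp

lemma bdd_above_eigenvalues:
  assumes "bounded (\<Union>t\<in>{0<..<T}. eigenvalues (herm1 (A t)))"
  shows "bdd_above (insert 0 {\<bar>x\<bar> | x t. 0 < t \<and> t < T \<and> complex_of_real x \<in> eigenvalues (herm1 (A t)) \<and> P x})"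
proof -
  obtain B where B: "\<And>z. z \<in> (\<Union>t\<in>{0<..<T}. eigenvalues (herm1 (A t))) \<Longrightarrow> cmod z \<le> B"
    using assms unfolding bounded_iff by blast
  have "\<bar>x\<bar> \<le> max 0 B" if "0 < t" "t < T" "complex_of_real x \<in> eigenvalues (herm1 (A t))" for x t
  proof -
    have "cmod (complex_of_real x) \<le> B" using that by (intro B) auto
    then show ?thesis by simp
  qed
  then show ?thesis by (intro bdd_aboveI[of _ "max 0 B"]) auto
qed

text \<open>The largest Rayleigh quotient is an eigenvalue. If positive, it is among the numbers
  under the supremum; otherwise the inserted 0 dominates it. The lower bound is the same argument
  for \<open>- herm1 (A t)\<close>.\<close>

lemma rayleigh_herm1_le:
  fixes A :: "real \<Rightarrow> complex^'n^'n"
  assumes "bounded (\<Union>t\<in>{0<..<T}. eigenvalues (herm1 (A t)))" "0 < t" "t < T"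
  shows "x \<bullet> (herm1 (A t) *v x) \<le> lam_plus T A * (norm x)\<^sup>2"
    and "- (lam_minus T A * (norm x)\<^sup>2) \<le> x \<bullet> (herm1 (A t) *v x)"
proof -
  let ?H = "herm1 (A t)"
  let ?S = "\<lambda>P. insert 0 {\<bar>x\<bar> | x t. 0 < t \<and> t < T \<and> complex_of_real x \<in> eigenvalues (herm1 (A t)) \<and> P x}"
  have bdd: "bdd_above (?S P)" for P
    by (rule bdd_above_eigenvalues[OF assms(1)])
  have eig: "complex_of_real M \<in> eigenvalues ?H" if "v \<noteq> 0" "?H *v v = M *\<^sub>R v" for v M
    using that by (auto simp: eigenvalues_def scaleR_conv_scalar_mult)
  have *: "\<bar>M\<bar> \<le> Sup (?S P)" if "v \<noteq> 0" "?H *v v = M *\<^sub>R v" "P M" for v M P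
    using that eig[of v M] assms(2,3) by (intro cSup_upper bdd) auto
  have nonneg: "0 \<le> Sup (?S P)" for P by (intro cSup_upper bdd) auto
  obtain M v where 1: "v \<noteq> 0" "?H *v v = M *\<^sub>R v" "\<And>x. x \<bullet> (?H *v x) \<le> M * (norm x)\<^sup>2"
    by (rule rayleigh_max[of "\<lambda>x. ?H *v x", OF linear_matrix_vector_complex inner_herm1]) blast
  have "M \<le> lam_plus T A"
    using *[of v M "\<lambda>x. x > 0"] nonneg[of "\<lambda>x. x > 0"] 1(1,2) unfolding lam_plus_def by linarith
  then show "x \<bullet> (?H *v x) \<le> lam_plus T A * (norm x)\<^sup>2"
    by (intro order_trans[OF 1(3)] mult_right_mono) auto
  obtain M v where 2: "v \<noteq> 0" "- (?H *v v) = M *\<^sub>R v" "\<And>x. x \<bullet> - (?H *v x) \<le> M * (norm x)\<^sup>2"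
  proof (rule rayleigh_max[of "\<lambda>x. - (?H *v x)"])
    show "linear (\<lambda>x. - (?H *v x))"
      by (intro linear_compose_neg linear_matrix_vector_complex)
    show "x \<bullet> - (?H *v y) = - (?H *v x) \<bullet> y" for x y
      using inner_herm1[of x "A t" y] by simp
  qed blast
  have "?H *v v = (- M) *\<^sub>R v" using 2(2) by (metis minus_minus scaleR_minus_left)
  then have "M \<le> lam_minus T A"
    using *[of v "- M" "\<lambda>x. x < 0"] nonneg[of "\<lambda>x. x < 0"] 2(1) unfolding lam_minus_def by linarith
  then have "x \<bullet> - (?H *v x) \<le> lam_minus T A * (norm x)\<^sup>2"
    by (intro order_trans[OF 2(3)] mult_right_mono) auto
  then show "- (lam_minus T A * (norm x)\<^sup>2) \<le> x \<bullet> (?H *v x)" by simp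
qed

lemma lam_nonneg:
  assumes "bounded (\<Union>t\<in>{0<..<T}. eigenvalues (herm1 (A t)))"
  shows "0 \<le> lam_plus T A" "0 \<le> lam_minus T A"
  unfolding lam_plus_def lam_minus_def by (intro cSup_upper bdd_above_eigenvalues assms; simp)+

section \<open>Finite speed of propagation\<close>

text \<open>The boundaries of the integration interval move with the extremal characteristic speeds of
  the symmetric hyperbolic equation \<open>v\<^sub>t = S v - H v\<^sub>p\<close>, so nothing flows in. Only finite sums
  \<open>v t p = (\<Sum>k\<in>J. f k p *\<^sub>R z k t)\<close> are considered: this makes differentiation under the integral
  elementary although \<open>H\<close> need not even be measurable in time.\<close>

lemma energy_domain_of_dependence:
  fixes f f' :: "'k \<Rightarrow> real \<Rightarrow> real" and z z' :: "'k \<Rightarrow> real \<Rightarrow> 'v::euclidean_space"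
    and H S :: "real \<Rightarrow> 'v \<Rightarrow> 'v"
  assumes T: "T > 0" and ab: "a \<le> b" and nonneg: "0 \<le> \<alpha>" "0 \<le> \<beta>"
    and f: "\<And>k p. k \<in> J \<Longrightarrow> (f k has_real_derivative f' k p) (at p)"
    and z: "\<And>k t. k \<in> J \<Longrightarrow> 0 < t \<Longrightarrow> t < T \<Longrightarrow> (z k has_vector_derivative z' k t) (at t)"
    and z_cont: "\<And>k. k \<in> J \<Longrightarrow> continuous_on {0..T} (z k)"
    and lin: "\<And>t. linear (H t)" and sa: "\<And>t x y. x \<bullet> H t y = H t x \<bullet> y"
    and upper: "\<And>t x. 0 < t \<Longrightarrow> t < T \<Longrightarrow> x \<bullet> H t x \<le> \<alpha> * (norm x)\<^sup>2"
    and lower: "\<And>t x. 0 < t \<Longrightarrow> t < T \<Longrightarrow> - (\<beta> * (norm x)\<^sup>2) \<le> x \<bullet> H t x"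
    and skew: "\<And>t x. x \<bullet> S t x = 0"
    and pde: "\<And>t p. 0 < t \<Longrightarrow> t < T \<Longrightarrow>
       (\<Sum>k\<in>J. f k p *\<^sub>R z' k t) = S t (\<Sum>k\<in>J. f k p *\<^sub>R z k t) - H t (\<Sum>k\<in>J. f' k p *\<^sub>R z k t)"
  shows "integral {a..b} (\<lambda>p. (norm (\<Sum>k\<in>J. f k p *\<^sub>R z k T))\<^sup>2)
       \<le> integral {a - \<alpha> * T..b + \<beta> * T} (\<lambda>p. (norm (\<Sum>k\<in>J. f k p *\<^sub>R z k 0))\<^sup>2)"
proof -
  define q where "q t p = (\<Sum>k\<in>J. f k p *\<^sub>R z k t)" for t p
  define dq where "dq t p = (\<Sum>k\<in>J. f' k p *\<^sub>R z k t)" for t p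
  \<comment> \<open>The moving interval shrinks in time and reaches \<open>{a..b}\<close> at time
    \<open>T\<close>.\<close>
  define A where "A t = a - \<alpha> * (T - t)" for t
  define B where "B t = b + \<beta> * (T - t)" for t
  \<comment> \<open>The margin of 1 keeps the moving end points inside the open interval, where
    \<open>\<Psi>\<close> has two-sided derivatives.\<close>
  define c d where "c = A 0 - 1" and "d = B 0 + 1"
  define \<Psi> where "\<Psi> k m x = integral {c..x} (\<lambda>p. f k p * f m p)" for k m x
  \<comment> \<open>Expanding the square separates the variables: time enters only through
    coefficients and end points, so the product and chain rules suffice to differentiate the
    energy.\<close>
  define E where "E t = (\<Sum>k\<in>J. \<Sum>m\<in>J. (z k t \<bullet> z m t) * (\<Psi> k m (B t) - \<Psi> k m (A t)))" for t
  have f_cont: "continuous_on U (f k)" if "k \<in> J" for k U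
    by (rule DERIV_continuous_on[OF has_field_derivative_at_within[OF f[OF that]]])
  have AB: "c < A t" "A t \<le> B t" "B t < d" if "0 \<le> t" "t \<le> T" for t
  proof -
    have "\<alpha> * (T - t) \<le> \<alpha> * T" "\<beta> * (T - t) \<le> \<beta> * T" "0 \<le> \<alpha> * (T - t)" "0 \<le> \<beta> * (T - t)"
      using that nonneg by (auto intro!: mult_left_mono)
    then show "c < A t" "A t \<le> B t" "B t < d"
      using ab by (auto simp: A_def B_def c_def d_def)
  qed
  have \<Psi>_deriv: "(\<Psi> k m has_real_derivative f k x * f m x) (at x)" if "k \<in> J" "m \<in> J" "c < x" "x < d" for k m x
  proof -
    have "(\<Psi> k m has_real_derivative f k x * f m x) (at x within {c..d})"
      unfolding \<Psi>_def using that
      by (intro integral_has_real_derivative continuous_intros f_cont) auto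
    moreover have "at x within {c..d} = at x"
      using that by (intro at_within_interior) (simp add: interior_atLeastAtMost_real)
    ultimately show ?thesis by simp
  qed
  have \<Psi>_diff: "(\<Sum>k\<in>J. \<Sum>m\<in>J. X k m * (\<Psi> k m y - \<Psi> k m x)) = integral {x..y} (\<lambda>p. \<Sum>k\<in>J. \<Sum>m\<in>J. X k m * (f k p * f m p))"
    if "c \<le> x" "x \<le> y" for X x y
  proof -
    have "\<Psi> k m y - \<Psi> k m x = integral {x..y} (\<lambda>p. f k p * f m p)" if "k \<in> J" "m \<in> J" for k m
      using Henstock_Kurzweil_Integration.integral_combine[OF \<open>c \<le> x\<close> \<open>x \<le> y\<close>, of "\<lambda>p. f k p * f m p"]
      unfolding \<Psi>_def by (simp add: integrable_continuous_interval continuous_on_mult f_cont that)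
    then have "(\<Sum>k\<in>J. \<Sum>m\<in>J. X k m * (\<Psi> k m y - \<Psi> k m x))
        = (\<Sum>k\<in>J. \<Sum>m\<in>J. integral {x..y} (\<lambda>p. X k m * (f k p * f m p)))"
      by (intro sum.cong refl) simp
    also have "\<dots> = integral {x..y} (\<lambda>p. \<Sum>k\<in>J. \<Sum>m\<in>J. X k m * (f k p * f m p))"
    \<comment> \<open>For infinite \<open>J\<close> all sums over \<open>J\<close> are 0 by
      convention.\<close>
    proof (cases "finite J")
      case True
      have int: "(\<lambda>p. X k m * (f k p * f m p)) integrable_on {x..y}" if "k \<in> J" "m \<in> J" for k m
        by (intro integrable_continuous_interval continuous_intros f_cont that)
      have "integral {x..y} (\<lambda>p. \<Sum>k\<in>J. \<Sum>m\<in>J. X k m * (f k p * f m p))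
          = (\<Sum>k\<in>J. integral {x..y} (\<lambda>p. \<Sum>m\<in>J. X k m * (f k p * f m p)))"
        by (intro Henstock_Kurzweil_Integration.integral_sum integrable_sum True int)
      also have "\<dots> = (\<Sum>k\<in>J. \<Sum>m\<in>J. integral {x..y} (\<lambda>p. X k m * (f k p * f m p)))"
        by (intro sum.cong refl Henstock_Kurzweil_Integration.integral_sum True int)
      finally show ?thesis ..
    qed auto
    finally show ?thesis .
  qed
  have E_eq: "E t = integral {A t..B t} (\<lambda>p. (norm (q t p))\<^sup>2)" if "0 \<le> t" "t \<le> T" for t
  proof -
    have "(norm (q t p))\<^sup>2 = (\<Sum>k\<in>J. \<Sum>m\<in>J. (z k t \<bullet> z m t) * (f k p * f m p))" for p
      unfolding q_def power2_norm_eq_inner inner_sum_left inner_sum_right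
      by (intro sum.cong refl) (simp add: inner_commute)
    then show ?thesis
      unfolding E_def using AB[OF that] by (subst \<Psi>_diff) simp_all
  qed
  have E_cont: "continuous_on {0..T} E"
  proof -
    have "continuous_on {0..T} (\<lambda>t. \<Psi> k m (B t))" "continuous_on {0..T} (\<lambda>t. \<Psi> k m (A t))"
      if "k \<in> J" "m \<in> J" for k m
    proof -
      have "continuous_on {c<..<d} (\<Psi> k m)"
        by (intro DERIV_continuous_on[OF has_field_derivative_at_within[OF \<Psi>_deriv]] that) auto
      moreover have "continuous_on {0..T} A" "continuous_on {0..T} B"
        unfolding A_def B_def by (auto intro!: continuous_intros)
      moreover have "A t \<in> {c<..<d}" "B t \<in> {c<..<d}" if "t \<in> {0..T}" for t
        using AB[of t] that by auto
      ultimately show "continuous_on {0..T} (\<lambda>t. \<Psi> k m (B t))" "continuous_on {0..T} (\<lambda>t. \<Psi> k m (A t))"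
        by (auto elim!: continuous_on_compose2)
    qed
    then show ?thesis
      unfolding E_def by (intro continuous_intros z_cont) auto
  qed
  have E_deriv: "\<exists>y. DERIV E t :> y \<and> y \<le> 0" if t: "0 < t" "t < T" for t
  proof -
    have ABt: "c < A t" "A t < d" "c < B t" "B t < d" "A t \<le> B t" using AB[of t] t by auto
    define Q where "Q p = q t p \<bullet> H t (q t p)" for p
    define y where "y = (\<Sum>k\<in>J. \<Sum>m\<in>J.
        (z k t \<bullet> z' m t + z' k t \<bullet> z m t) * (\<Psi> k m (B t) - \<Psi> k m (A t))
        + (z k t \<bullet> z m t) * (f k (B t) * f m (B t) * (- \<beta>) - f k (A t) * f m (A t) * \<alpha>))"
    have "DERIV E t :> y"
      unfolding E_def y_def
    proof (intro DERIV_sum)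
      fix k m assume km: "k \<in> J" "m \<in> J"
      have 1: "((\<lambda>t. z k t \<bullet> z m t) has_real_derivative (z k t \<bullet> z' m t + z' k t \<bullet> z m t)) (at t)"
        using has_derivative_inner[OF z[OF km(1) t, unfolded has_vector_derivative_def] z[OF km(2) t, unfolded has_vector_derivative_def]]
        unfolding has_field_derivative_def
        by (rule has_derivative_eq_rhs) (auto simp: fun_eq_iff algebra_simps)
      have dA: "(A has_real_derivative \<alpha>) (at t)" and dB: "(B has_real_derivative - \<beta>) (at t)"
        unfolding A_def B_def by (auto intro!: derivative_eq_intros)
      have 2: "((\<lambda>t. \<Psi> k m (B t) - \<Psi> k m (A t)) has_real_derivative
          (f k (B t) * f m (B t) * (- \<beta>) - f k (A t) * f m (A t) * \<alpha>)) (at t)"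
        by (intro DERIV_diff DERIV_chain2[OF \<Psi>_deriv dA] DERIV_chain2[OF \<Psi>_deriv dB] km ABt)
      show "((\<lambda>t. (z k t \<bullet> z m t) * (\<Psi> k m (B t) - \<Psi> k m (A t))) has_real_derivative
          (z k t \<bullet> z' m t + z' k t \<bullet> z m t) * (\<Psi> k m (B t) - \<Psi> k m (A t))
        + (z k t \<bullet> z m t) * (f k (B t) * f m (B t) * (- \<beta>) - f k (A t) * f m (A t) * \<alpha>)) (at t)"
        using DERIV_mult[OF 1 2] by (simp add: algebra_simps)
    qed
    moreover have "y = (\<Sum>k\<in>J. \<Sum>m\<in>J. (z k t \<bullet> z' m t + z' k t \<bullet> z m t) * (\<Psi> k m (B t) - \<Psi> k m (A t)))
        - \<beta> * (norm (q t (B t)))\<^sup>2 - \<alpha> * (norm (q t (A t)))\<^sup>2"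
      unfolding y_def q_def power2_norm_eq_inner inner_sum_left inner_sum_right sum_distrib_left
        sum_subtractf[symmetric]
      by (intro sum.cong refl) (simp add: algebra_simps inner_commute)
    \<comment> \<open>The skew part drops out, and by symmetry of \<open>H\<close> the remaining
      integrand is the exact derivative of \<open>- Q\<close>. Only the flux through the two end
      points is left.\<close>
    moreover have "(\<Sum>k\<in>J. \<Sum>m\<in>J. (z k t \<bullet> z' m t + z' k t \<bullet> z m t) * (\<Psi> k m (B t) - \<Psi> k m (A t))) = Q (A t) - Q (B t)"
    proof -
      have Q': "(Q has_real_derivative 2 * (q t p \<bullet> H t (dq t p))) (at p)" for p
      proof -
        have qd: "(q t has_derivative (\<lambda>s. s *\<^sub>R dq t p)) (at p)"
          unfolding q_def dq_def scaleR_sum_right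
          by (rule has_derivative_sum, rule has_derivative_eq_rhs,
              rule has_derivative_scaleR[OF _ has_derivative_const])
             (auto intro!: f[unfolded has_field_derivative_def] simp: fun_eq_iff mult.commute)
        have bl: "bounded_linear (H t)" using lin by (simp add: linear_conv_bounded_linear)
        have sym: "dq t p \<bullet> H t (q t p) = q t p \<bullet> H t (dq t p)"
          by (subst sa) (rule inner_commute)
        from has_derivative_inner[OF qd bounded_linear.has_derivative[OF bl qd]]
        show ?thesis
          unfolding Q_def[abs_def] has_field_derivative_def
          by (rule has_derivative_eq_rhs)
             (simp add: fun_eq_iff linear_scale[OF lin] sym)
      qed
      have "(\<Sum>k\<in>J. \<Sum>m\<in>J. (z k t \<bullet> z' m t + z' k t \<bullet> z m t) * (f k p * f m p)) = - (2 * (q t p \<bullet> H t (dq t p)))" for p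
      proof -
        have "(\<Sum>k\<in>J. \<Sum>m\<in>J. (z k t \<bullet> z' m t + z' k t \<bullet> z m t) * (f k p * f m p))
            = q t p \<bullet> (\<Sum>k\<in>J. f k p *\<^sub>R z' k t) + (\<Sum>k\<in>J. f k p *\<^sub>R z' k t) \<bullet> q t p"
          unfolding q_def inner_sum_left inner_sum_right sum.distrib[symmetric]
          by (intro sum.cong refl) (simp add: algebra_simps inner_commute)
        also have "\<dots> = - (2 * (q t p \<bullet> H t (dq t p)))"
          unfolding pde[OF t] q_def[symmetric] dq_def[symmetric]
          using skew[of "q t p" t] by (simp add: inner_diff inner_commute)
        finally show ?thesis .
      qed
      then have "(\<Sum>k\<in>J. \<Sum>m\<in>J. (z k t \<bullet> z' m t + z' k t \<bullet> z m t) * (\<Psi> k m (B t) - \<Psi> k m (A t)))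
          = integral {A t..B t} (\<lambda>p. - (2 * (q t p \<bullet> H t (dq t p))))"
        using ABt by (subst \<Psi>_diff) simp_all
      also have "\<dots> = - Q (B t) - - Q (A t)"
      proof (intro integral_unique fundamental_theorem_of_calculus ABt)
        fix p show "((\<lambda>p. - Q p) has_vector_derivative - (2 * (q t p \<bullet> H t (dq t p)))) (at p within {A t..B t})"
          unfolding has_real_derivative_iff_has_vector_derivative[symmetric]
          by (intro DERIV_minus has_field_derivative_at_within[OF Q'])
      qed
      finally show ?thesis by simp
    qed
    \<comment> \<open>The speed bounds make the flux at each end no larger than the loss caused by
      the motion of that end.\<close>
    moreover have "Q (A t) \<le> \<alpha> * (norm (q t (A t)))\<^sup>2" "- (\<beta> * (norm (q t (B t)))\<^sup>2) \<le> Q (B t)"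
      unfolding Q_def by (intro upper lower t)+
    ultimately show ?thesis by (intro exI[of _ y]) auto
  qed
  \<comment> \<open>The sign of the derivative is known only for \<open>0 < t < T\<close>;
    continuity extends the conclusion to the end points.\<close>
  have "E T \<le> E 0"
    using T E_deriv E_cont by (intro DERIV_nonpos_imp_decreasing_open[of 0 T E]) auto
  moreover have "E T = integral {a..b} (\<lambda>p. (norm (q T p))\<^sup>2)"
    using T by (subst E_eq) (auto simp: A_def B_def)
  moreover have "E 0 = integral {a - \<alpha> * T..b + \<beta> * T} (\<lambda>p. (norm (q 0 p))\<^sup>2)"
    using T by (subst E_eq) (auto simp: A_def B_def)
  ultimately show ?thesis by (simp add: q_def)
qed

section \<open>The semi-discrete error\<close>

lemma has_vector_derivative_interior:
  assumes "(g has_vector_derivative g') (at t within {0..T})" "0 < t" "t < (T::real)"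
  shows "(g has_vector_derivative g') (at t)"
proof -
  have "at t within {0..T} = at t"
    using assms(2,3) by (intro at_within_interior) (simp add: interior_atLeastAtMost_real)
  then show ?thesis using assms(1) by simp
qed

text \<open>The function \<open>g\<close> is nondecreasing, because the skew part does not affect
  the norm and the Hermitian part shrinks it at rate at most \<open>lam_minus T A\<close>. This lets
  the mesh term be stated with \<open>u T\<close>.\<close>

lemma norm_initial_le:
  fixes A :: "real \<Rightarrow> complex^'n^'n"
  assumes T: "T > 0" and bdd: "bounded (\<Union>t\<in>{0<..<T}. eigenvalues (herm1 (A t)))"
    and ode: "solves_linear_ode T A u0 u"
  shows "norm u0 \<le> exp (lam_minus T A * T) * norm (u T)"
proof -
  let ?l = "lam_minus T A"
  define g where "g t = exp (2 * ?l * t) * (u t \<bullet> u t)" for t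
  have u: "(u has_vector_derivative (A t *v u t)) (at t within {0..T})" if "t \<in> {0..T}" for t
    using ode that by (simp add: solves_linear_ode_def)
  have "continuous_on {0..T} u"
    using u by (meson continuous_on_eq_continuous_within has_vector_derivative_continuous)
  then have "continuous_on {0..T} g"
    unfolding g_def by (intro continuous_intros)
  moreover have "\<exists>y. DERIV g t :> y \<and> y \<ge> 0" if t: "0 < t" "t < T" for t
  proof -
    have "(u has_vector_derivative (A t *v u t)) (at t)"
      using u t by (intro has_vector_derivative_interior[OF _ t]) auto
    then have ud: "(u has_derivative (\<lambda>s. s *\<^sub>R (A t *v u t))) (at t)"
      by (simp add: has_vector_derivative_def)
    have "((\<lambda>t. u t \<bullet> u t) has_real_derivative 2 * (u t \<bullet> (A t *v u t))) (at t)"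
      unfolding has_field_derivative_def
      by (rule has_derivative_eq_rhs[OF has_derivative_inner[OF ud ud]])
         (simp add: fun_eq_iff inner_commute)
    then have "DERIV g t :> exp (2 * ?l * t) * (2 * ?l * (u t \<bullet> u t) + 2 * (u t \<bullet> (A t *v u t)))"
      unfolding g_def by (auto intro!: derivative_eq_intros simp: algebra_simps)
    moreover have "u t \<bullet> (A t *v u t) = u t \<bullet> (herm1 (A t) *v u t)"
      using inner_skew_part[of "u t" "A t"]
      by (simp add: matrix_vector_mult_diff_rdistrib inner_diff)
    then have "0 \<le> 2 * ?l * (u t \<bullet> u t) + 2 * (u t \<bullet> (A t *v u t))"
      using rayleigh_herm1_le(2)[OF bdd t, of "u t"] by (simp add: power2_norm_eq_inner)
    ultimately show ?thesis by (meson exp_ge_zero mult_nonneg_nonneg)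
  qed
  ultimately have "g 0 \<le> g T"
    using T by (intro DERIV_nonneg_imp_increasing_open[of 0 T g]) auto
  then have "(norm u0)\<^sup>2 \<le> (exp (?l * T) * norm (u T))\<^sup>2"
    using ode by (simp add: g_def solves_linear_ode_def power_mult_distrib power2_norm_eq_inner
        mult_ac flip: exp_double)
  then show ?thesis by (rule power2_le_imp_le) simp
qed

lemma norm_scalar_mult: "norm (c *s (x :: complex^'n)) = cmod c * norm x"
  by (simp add: norm_vec_def norm_mult L2_set_right_distrib)

text \<open>The energy estimate admits only real functions of \<open>p\<close> as factors, so each
  complex mode is split into two real terms.\<close>

lemma mode_conv: "mode L N l p *s x
    = cos (freq L N l * (p + pi * L)) *\<^sub>R x + sin (freq L N l * (p + pi * L)) *\<^sub>R (\<i> *s x)"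
proof -
  have "mode L N l p = complex_of_real (cos (freq L N l * (p + pi * L))) + \<i> * complex_of_real (sin (freq L N l * (p + pi * L)))"
    by (simp only: mode_def cis_conv_exp[symmetric] cis.code Complex_eq)
  then show ?thesis
    unfolding scaleR_conv_scalar_mult by (simp add: vec_eq_iff algebra_simps)
qed

lemma tensor_app_diag:
  assumes "l < N"
  shows "tensor_app N (diag_mat d) B w l = d l *s (B *v w l)"
proof -
  have "tensor_app N (diag_mat d) B w l = (\<Sum>k<N. if k = l then d l *s (B *v w l) else 0)"
    unfolding tensor_app_def diag_mat_def by (intro sum.cong) auto
  then show ?thesis using assms by simp
qed

text \<open>The inverse Fourier matrix acts on the grid index alone, so \<open>u0\<close> factors
  out and a scalar trigonometric interpolant remains.\<close>

lemma w_h_initial: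
  assumes "solves_schroedingerized T A u0 L N w" "L > 0" "N > 0"
  obtains c where "\<And>p. w_h L N (w 0) p = trig_poly L N c p *s u0"
    and "\<And>j. j < N \<Longrightarrow> trig_poly L N c (grid L N j) = exp (- \<bar>grid L N j\<bar>)"
proof
  let ?g = "\<lambda>k. complex_of_real (exp (- \<bar>grid L N k\<bar>))"
  let ?c = "\<lambda>l. \<Sum>k<N. inv_mat N (Phi L N) l k * ?g k"
  have init: "initial_grid_data L N u0 j = ?g j *s u0" if "j < N" for j
  proof -
    have "initial_grid_data L N u0 j = (\<Sum>k<N. if k = j then ?g j *s u0 else 0)"
      unfolding initial_grid_data_def tensor_vec_def ket_def
      by (intro sum.cong) (auto simp: scaleR_conv_scalar_mult)
    then show ?thesis using that by simp
  qed
  have w0: "w 0 l = ?c l *s u0" if "l < N" for l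
  proof -
    have "w 0 l = (\<Sum>k<N. inv_mat N (Phi L N) l k *s (?g k *s u0))"
      using assms(1) that init by (simp add: solves_schroedingerized_def tensor_app_def)
    then show ?thesis by (simp add: vec_eq_iff sum_distrib_right mult.assoc)
  qed
  have trig: "(\<Sum>l<N. mode L N l p *s (c l *s u0)) = trig_poly L N c p *s u0" for c p
    unfolding vec_eq_iff trig_poly_def sum_component vector_smult_component sum_distrib_right
    by (simp add: mult_ac)
  show "w_h L N (w 0) p = trig_poly L N ?c p *s u0" for p
  proof -
    have "w_h L N (w 0) p = (\<Sum>l<N. mode L N l p *s (?c l *s u0))"
      unfolding w_h_def by (intro sum.cong refl) (simp only: w0 lessThan_iff)
    also have "\<dots> = trig_poly L N ?c p *s u0"
      by (rule trig)
    finally show ?thesis .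
  qed
  show "trig_poly L N ?c (grid L N j) = exp (- \<bar>grid L N j\<bar>)" if "j < N" for j
  proof -
    have "trig_poly L N ?c (grid L N j) = (\<Sum>l<N. \<Sum>k<N. ?g k * (Phi L N j l * inv_mat N (Phi L N) l k))"
      unfolding trig_poly_grid sum_distrib_right by (intro sum.cong refl) (simp only: mult_ac)
    also have "\<dots> = (\<Sum>k<N. ?g k * (\<Sum>l<N. Phi L N j l * inv_mat N (Phi L N) l k))"
      by (subst sum.swap) (simp only: sum_distrib_left)
    also have "\<dots> = (\<Sum>k<N. ?g k * id_mat j k)"
      using that by (intro sum.cong refl) (simp add: inv_mat_Phi[OF assms(2,3)])
    also have "\<dots> = ?g j"
      using that by (simp add: id_mat_def diag_mat_def if_distrib cong: if_cong)
    finally show ?thesis .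
  qed
qed

lemma L2_norm_on_open_interval:
  assumes "continuous_on {a..b} f"
  shows "L2_norm_on {a<..<b} f = sqrt (integral {a..b} (\<lambda>p. (norm (f p))\<^sup>2))"
proof -
  have "set_integrable lborel {a..b} (\<lambda>p. (norm (f p))\<^sup>2)"
    by (intro borel_integrable_atLeastAtMost' continuous_intros assms)
  then have "set_integrable lborel {a<..<b} (\<lambda>p. (norm (f p))\<^sup>2)"
    by (rule set_integrable_subset) auto
  then show ?thesis
    unfolding L2_norm_on_def by (simp add: set_borel_integral_eq_integral integral_open_interval_real)
qed

lemma semidiscrete_energy:
  fixes A :: "real \<Rightarrow> complex^'n^'n"
  assumes T: "T > 0" and bdd: "bounded (\<Union>t\<in>{0<..<T}. eigenvalues (herm1 (A t)))" and ab: "a \<le> b"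
    and ode: "solves_linear_ode T A u0 u" and schr: "solves_schroedingerized T A u0 L N w"
  shows "integral {a..b} (\<lambda>p. (norm (w_h L N (w T) p - exp (- p) *\<^sub>R u T))\<^sup>2)
       \<le> integral {a - lam_plus T A * T..b + lam_minus T A * T}
            (\<lambda>p. (norm (w_h L N (w 0) p - exp (- p) *\<^sub>R u0))\<^sup>2)"
proof -
  \<comment> \<open>The three kinds of index stand for the cosines with \<open>w t l\<close>, the
    sines with \<open>\<i> *s w t l\<close>, and \<open>exp (- p)\<close> with
    \<open>- u t\<close>.\<close>
  define J where "J = {..<N} <+> ({..<N} <+> {()})"
  define H where "H t x = herm1 (A t) *v x" for t x
  define S where "S t x = (A t - herm1 (A t)) *v x" for t x
  define \<mu> where "\<mu> = freq L N"
  define f :: "nat + nat + unit \<Rightarrow> real \<Rightarrow> real" where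
    "f = case_sum (\<lambda>l p. cos (\<mu> l * (p + pi * L))) (case_sum (\<lambda>l p. sin (\<mu> l * (p + pi * L))) (\<lambda>_ p. exp (- p)))"
  define f' :: "nat + nat + unit \<Rightarrow> real \<Rightarrow> real" where
    "f' = case_sum (\<lambda>l p. - \<mu> l * sin (\<mu> l * (p + pi * L)))
        (case_sum (\<lambda>l p. \<mu> l * cos (\<mu> l * (p + pi * L))) (\<lambda>_ p. - exp (- p)))"
  define z :: "nat + nat + unit \<Rightarrow> real \<Rightarrow> complex^'n" where "z = case_sum (\<lambda>l t. w t l) (case_sum (\<lambda>l t. \<i> *s w t l) (\<lambda>_ t. - u t))"
  define z' :: "nat + nat + unit \<Rightarrow> real \<Rightarrow> complex^'n" where "z' = case_sum (\<lambda>l t. S t (w t l) - \<mu> l *\<^sub>R H t (\<i> *s w t l))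
      (case_sum (\<lambda>l t. S t (\<i> *s w t l) + \<mu> l *\<^sub>R H t (w t l)) (\<lambda>_ t. - (S t (u t) + H t (u t))))"
  have sum_J: "(\<Sum>k\<in>J. F k) = (\<Sum>l<N. F (Inl l) + F (Inr (Inl l))) + F (Inr (Inr ()))"
    for F :: "nat + nat + unit \<Rightarrow> complex^'n"
    by (simp add: J_def sum.Plus sum.distrib add.assoc)
  have linH: "linear (H t)" and linS: "linear (S t)" for t
    unfolding H_def[abs_def] S_def[abs_def] by (rule linear_matrix_vector_complex)+
  have bl: "bounded_linear (\<lambda>x::complex^'n. \<i> *s x)"
    unfolding linear_conv_bounded_linear[symmetric]
    by (intro linearI) (auto simp: vec_eq_iff algebra_simps)
  have z_deriv: "(z k has_vector_derivative z' k t) (at t within {0..T})" if "k \<in> J" "t \<in> {0..T}" for k t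
  proof -
    have w: "((\<lambda>s. w s l) has_vector_derivative (S t (w t l) - \<mu> l *\<^sub>R H t (\<i> *s w t l))) (at t within {0..T})"
      if "l < N" for l
    proof -
      have "(- \<i>) *s (tensor_app N (D_p L N) (herm1 (A t)) (w t) l - tensor_app N id_mat (herm2 (A t)) (w t) l)
          = S t (w t l) - \<mu> l *\<^sub>R H t (\<i> *s w t l)"
        unfolding S_def H_def \<mu>_def D_p_def id_mat_def tensor_app_diag[OF that] ii_herm2[symmetric]
          vector_scalar_commute scaleR_conv_scalar_mult
        by (simp add: vec_eq_iff algebra_simps)
      then show ?thesis
        using schr \<open>t \<in> {0..T}\<close> that unfolding solves_schroedingerized_def by metis
    qed
    have iw: "((\<lambda>s. \<i> *s w s l) has_vector_derivative (S t (\<i> *s w t l) + \<mu> l *\<^sub>R H t (w t l))) (at t within {0..T})"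
      if "l < N" for l
    proof -
      have "\<i> *s (S t (w t l) - \<mu> l *\<^sub>R H t (\<i> *s w t l)) = S t (\<i> *s w t l) + \<mu> l *\<^sub>R H t (w t l)"
        unfolding S_def H_def vector_scalar_commute scaleR_conv_scalar_mult
        by (simp add: vec_eq_iff algebra_simps)
      then show ?thesis
        using bounded_linear.has_vector_derivative[OF bl w[OF that]] by simp
    qed
    have u: "((\<lambda>s. - u s) has_vector_derivative - (S t (u t) + H t (u t))) (at t within {0..T})"
      using ode \<open>t \<in> {0..T}\<close>
      by (intro has_vector_derivative_minus)
         (simp add: solves_linear_ode_def S_def H_def matrix_vector_mult_diff_rdistrib)
    show ?thesis
      using that(1) w iw u unfolding J_def z_def z'_def by auto
  qed
  have q: "(\<Sum>k\<in>J. f k p *\<^sub>R z k t) = w_h L N (w t) p - exp (- p) *\<^sub>R u t" for p t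
    unfolding sum_J f_def z_def w_h_def mode_conv \<mu>_def by simp
  have "integral {a..b} (\<lambda>p. (norm (\<Sum>k\<in>J. f k p *\<^sub>R z k T))\<^sup>2)
       \<le> integral {a - lam_plus T A * T..b + lam_minus T A * T} (\<lambda>p. (norm (\<Sum>k\<in>J. f k p *\<^sub>R z k 0))\<^sup>2)"
  proof (rule energy_domain_of_dependence[OF T ab lam_nonneg[OF bdd], where f' = f' and z' = z' and H = H and S = S])
    show "(f k has_real_derivative f' k p) (at p)" for k p
      unfolding f_def f'_def by (auto split: sum.split intro!: derivative_eq_intros)
    show "(z k has_vector_derivative z' k t) (at t)" if "k \<in> J" "0 < t" "t < T" for k t
      using that by (intro has_vector_derivative_interior[OF z_deriv]) auto
    show "continuous_on {0..T} (z k)" if "k \<in> J" for k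
      using z_deriv[OF that] by (meson continuous_on_eq_continuous_within has_vector_derivative_continuous)
    show "linear (H t)" for t by (rule linH)
    show "x \<bullet> H t y = H t x \<bullet> y" for t x y unfolding H_def by (rule inner_herm1)
    show "x \<bullet> S t x = 0" for t x unfolding S_def by (rule inner_skew_part)
    show "x \<bullet> H t x \<le> lam_plus T A * (norm x)\<^sup>2" "- (lam_minus T A * (norm x)\<^sup>2) \<le> x \<bullet> H t x"
      if "0 < t" "t < T" for t x
      unfolding H_def using rayleigh_herm1_le[OF bdd that] by auto
    \<comment> \<open>Differentiation in \<open>p\<close> exchanges cosines and sines and negates
      \<open>exp (- p)\<close>, which matches the \<open>H\<close> terms of
      \<open>z'\<close>.\<close>
    show "(\<Sum>k\<in>J. f k p *\<^sub>R z' k t) = S t (\<Sum>k\<in>J. f k p *\<^sub>R z k t) - H t (\<Sum>k\<in>J. f' k p *\<^sub>R z k t)" for t p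
      unfolding linear_sum[OF linH] linear_sum[OF linS] linear_scale[OF linH] linear_scale[OF linS] sum_subtractf[symmetric]
      unfolding sum_J f_def f'_def z_def z'_def
      by (rule arg_cong2[where f = "(+)"], rule sum.cong[OF refl])
         (simp_all add: linear_neg[OF linH] linear_neg[OF linS] algebra_simps)
  qed
  then show ?thesis
    using ode by (simp add: q solves_linear_ode_def)
qed

text \<open>Recovering \<open>u\<close> multiplies the error by \<open>exp p\<close>, at most
  \<open>exp (pd + R)\<close> on the recovery interval. The energy estimate then reduces everything
  to a scalar error at time 0.\<close>

lemma semidiscrete_L2_error_le:
  fixes A :: "real \<Rightarrow> complex^'n^'n"
  assumes T: "T > 0" and bdd: "bounded (\<Union>t\<in>{0<..<T}. eigenvalues (herm1 (A t)))" and R: "R \<ge> 0"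
    and ode: "solves_linear_ode T A u0 u" and schr: "solves_schroedingerized T A u0 L N w"
    and w0: "\<And>p. w_h L N (w 0) p = trig_poly L N c p *s u0"
  shows "L2_norm_on {pd<..<pd + R} (\<lambda>p. u_h L N (w T) p - u T)
    \<le> exp (pd + R) * sqrt (integral {pd - lam_plus T A * T..pd + R + lam_minus T A * T}
         (\<lambda>p. (cmod (trig_poly L N c p - exp (- p)))\<^sup>2)) * norm u0"
proof -
  let ?v = "\<lambda>p. w_h L N (w T) p - exp (- p) *\<^sub>R u T"
  have cont: "continuous_on X (\<lambda>p. w_h L N (w T) p)" for X
    unfolding w_h_def mode_conv by (intro continuous_intros)
  have v_cont: "continuous_on X (\<lambda>p. (norm (?v p))\<^sup>2)" for X
    by (intro continuous_intros cont)
  have uh_cont: "continuous_on X (u_h L N (w T))" for X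
    unfolding u_h_def[abs_def] by (intro continuous_intros cont)
  then have u_cont: "continuous_on X (\<lambda>p. u_h L N (w T) p - u T)" for X
    by (intro continuous_intros)
  have "integral {pd..pd + R} (\<lambda>p. (norm (u_h L N (w T) p - u T))\<^sup>2)
      \<le> integral {pd..pd + R} (\<lambda>p. (exp (pd + R))\<^sup>2 * (norm (?v p))\<^sup>2)"
  proof (intro integral_le integrable_continuous_interval continuous_intros uh_cont cont)
    fix p assume p: "p \<in> {pd..pd + R}"
    have "u_h L N (w T) p - u T = exp p *\<^sub>R ?v p"
      by (simp add: u_h_def scaleR_diff_right flip: exp_add)
    then have "norm (u_h L N (w T) p - u T) = exp p * norm (?v p)" by simp
    also have "\<dots> \<le> exp (pd + R) * norm (?v p)"
      using p by (intro mult_right_mono) auto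
    finally show "(norm (u_h L N (w T) p - u T))\<^sup>2 \<le> (exp (pd + R))\<^sup>2 * (norm (?v p))\<^sup>2"
      unfolding power_mult_distrib[symmetric] by (intro power_mono) auto
  qed
  also have "\<dots> = (exp (pd + R))\<^sup>2 * integral {pd..pd + R} (\<lambda>p. (norm (?v p))\<^sup>2)"
    by simp
  also have "\<dots> \<le> (exp (pd + R))\<^sup>2 * integral {pd - lam_plus T A * T..pd + R + lam_minus T A * T}
         (\<lambda>p. (norm (w_h L N (w 0) p - exp (- p) *\<^sub>R u0))\<^sup>2)"
    using R by (intro mult_left_mono semidiscrete_energy[OF T bdd _ ode schr]) auto
  also have "(\<lambda>p. (norm (w_h L N (w 0) p - exp (- p) *\<^sub>R u0))\<^sup>2)
      = (\<lambda>p. (cmod (trig_poly L N c p - exp (- p)))\<^sup>2 * (norm u0)\<^sup>2)"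
    unfolding w0 scaleR_conv_scalar_mult vector_sub_rdistrib[symmetric] norm_scalar_mult power_mult_distrib ..
  finally have "integral {pd..pd + R} (\<lambda>p. (norm (u_h L N (w T) p - u T))\<^sup>2)
      \<le> (exp (pd + R))\<^sup>2 * (integral {pd - lam_plus T A * T..pd + R + lam_minus T A * T}
         (\<lambda>p. (cmod (trig_poly L N c p - exp (- p)))\<^sup>2) * (norm u0)\<^sup>2)"
    by simp
  from real_sqrt_le_mono[OF this] show ?thesis
    unfolding L2_norm_on_open_interval[OF u_cont] by (simp add: real_sqrt_mult mult_ac)
qed

section \<open>Initial error on the domain of dependence\<close>

lemma integral_initial_error_resolved:
  assumes "L > 0" "N > 0" "even N" "0 \<le> a" "b \<le> pi * L"
    and interp: "\<And>j. j < N \<Longrightarrow> trig_poly L N c (grid L N j) = exp (- \<bar>grid L N j\<bar>)"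
  shows "integral {a..b} (\<lambda>p. (cmod (trig_poly L N c p - exp (- p)))\<^sup>2) \<le> 8 * (mesh L N)\<^sup>2"
proof -
  have sub: "{a..b} \<subseteq> {- pi * L..pi * L}"
    using assms by (auto intro: order_trans[of _ 0])
  have int: "(\<lambda>p. (cmod (trig_poly L N c p - exp (- \<bar>p\<bar>)))\<^sup>2) integrable_on {x..y}" for x y
    by (intro integrable_continuous_interval continuous_intros continuous_on_trig_poly)
  \<comment> \<open>The interval lies in the region \<open>p \<ge> 0\<close>, so the wanted function
    and the interpolated one coincide there.\<close>
  have "integral {a..b} (\<lambda>p. (cmod (trig_poly L N c p - exp (- p)))\<^sup>2)
      = integral {a..b} (\<lambda>p. (cmod (trig_poly L N c p - exp (- \<bar>p\<bar>)))\<^sup>2)"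
    using assms(4) by (intro integral_cong) simp
  also have "\<dots> \<le> integral {- pi * L..pi * L} (\<lambda>p. (cmod (trig_poly L N c p - exp (- \<bar>p\<bar>)))\<^sup>2)"
    by (intro integral_subset_le sub int) auto
  also have "\<dots> \<le> 8 * (mesh L N)\<^sup>2"
    by (rule integral_interpolation_error_le[OF assms(1,2,3) interp])
  finally show ?thesis .
qed

text \<open>Beyond one period the interpolant repeats and need not be close to
  \<open>exp (- p)\<close>. Only its size is used: the interval is covered by \<open>m\<close> whole
  periods, on which interpolation is stable.\<close>

lemma integral_initial_error_unresolved:
  assumes "L > 0" "N > 0" "0 \<le> a" "a \<le> b" "pi * L < b"
    and interp: "\<And>j. j < N \<Longrightarrow> trig_poly L N c (grid L N j) = exp (- \<bar>grid L N j\<bar>)"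
  shows "integral {a..b} (\<lambda>p. (cmod (trig_poly L N c p - exp (- p)))\<^sup>2) \<le> 10 * b"
proof -
  let ?I = "trig_poly L N c"
  define P where "P = 2 * (pi * L)"
  have P: "P > 0" "pi * L = P / 2" using assms(1) by (auto simp: P_def)
  define m where "m = nat \<lceil>(b + P / 2) / P\<rceil>"
  have "0 \<le> (b + P / 2) / P" using P assms by simp
  then have "(b + P / 2) / P \<le> real m" "real m \<le> (b + P / 2) / P + 1"
    unfolding m_def by linarith+
  then have m: "b \<le> - (P / 2) + real m * P" "real m * P \<le> b + P / 2 + P"
    using P by (auto simp: field_simps)
  have "cmod (?I (grid L N j)) \<le> 1" if "j < N" for j
    unfolding interp[OF that] norm_of_real by simp
  note per = integral_trig_poly_periods_le[OF assms(1,2) this, of m]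
  have int: "(\<lambda>p. (cmod (?I p))\<^sup>2) integrable_on {x..y}" for x y
    by (intro integrable_continuous_interval continuous_intros continuous_on_trig_poly)
  have "integral {a..b} (\<lambda>p. (cmod (?I p - exp (- p)))\<^sup>2) \<le> integral {a..b} (\<lambda>p. 2 * (cmod (?I p))\<^sup>2 + 2)"
  proof (intro integral_le integrable_continuous_interval continuous_intros continuous_on_trig_poly)
    fix p assume "p \<in> {a..b}"
    then have "cmod (complex_of_real (exp (- p))) \<le> 1"
      using assms(3) by (simp only: norm_of_real) simp
    then have "cmod (?I p - exp (- p)) \<le> cmod (?I p) + 1"
      using norm_triangle_ineq4[of "?I p" "exp (- p)"] by linarith
    then have "(cmod (?I p - exp (- p)))\<^sup>2 \<le> (cmod (?I p) + 1)\<^sup>2"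
      by (intro power_mono) auto
    also have "\<dots> \<le> 2 * (cmod (?I p))\<^sup>2 + 2"
      using square_sum_le[of "cmod (?I p)" 1] by simp
    finally show "(cmod (?I p - exp (- p)))\<^sup>2 \<le> 2 * (cmod (?I p))\<^sup>2 + 2" .
  qed
  also have "\<dots> = 2 * integral {a..b} (\<lambda>p. (cmod (?I p))\<^sup>2) + 2 * (b - a)"
    using int assms(4) by (subst Henstock_Kurzweil_Integration.integral_add) (auto intro: integrable_on_cmult_left)
  also have "integral {a..b} (\<lambda>p. (cmod (?I p))\<^sup>2)
      \<le> integral {- pi * L..- pi * L + real m * (2 * pi * L)} (\<lambda>p. (cmod (?I p))\<^sup>2)"
    using m assms P by (intro integral_subset_le int) (auto simp: mult.assoc)
  also have "\<dots> \<le> b + P / 2 + P"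
    using per m(2) by (simp add: P_def mult.assoc)
  \<comment> \<open>Here \<open>P / 2 + P\<close> equals \<open>3 * (pi * L)\<close> and is
    therefore below \<open>3 * b\<close>.\<close>
  also have "2 * (b + P / 2 + P) + 2 * (b - a) \<le> 10 * b"
    using assms P by simp
  finally show ?thesis by simp
qed

text \<open>The bound \<open>exp R \<le> K\<close> expresses that \<open>exp R\<close> is of order
  1. The constant \<open>C\<close> is chosen after \<open>T\<close>, \<open>A\<close>,
  \<open>pd\<close> and \<open>K\<close> but before the accuracy, the mesh and the data. Bounded
  spectra make the suprema in \<open>lam_plus\<close> and \<open>lam_minus\<close>
  meaningful.\<close>

theorem theorem4p4:
  fixes T pd K :: real and A :: "real \<Rightarrow> complex^'n^'n"
  assumes T_pos: "T > 0"
    and spec_bdd: "bounded (\<Union>t\<in>{0<..<T}. eigenvalues (herm1 (A t)))"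
    and pd: "pd \<ge> lam_plus T A * T"
  shows "\<exists>C>0. \<forall>(\<epsilon>::real) (R::real) (L::real) (N::nat) (u0 :: complex^'n)
            (u :: real \<Rightarrow> complex^'n) (w :: real \<Rightarrow> nat \<Rightarrow> complex^'n).
      \<epsilon> > 0 \<longrightarrow> R \<ge> 1 \<longrightarrow> exp R \<le> K \<longrightarrow> L > 0 \<longrightarrow> N > 0 \<longrightarrow> even N \<longrightarrow>
      exp (- pi * L + 2 * lam_plus T A * T + R) \<le> \<epsilon> \<longrightarrow>
      exp (- pi * L + lam_minus T A * T + lam_plus T A * T + R) \<le> \<epsilon> \<longrightarrow>
      solves_linear_ode T A u0 u \<longrightarrow>
      solves_schroedingerized T A u0 L N w \<longrightarrow>
      L2_norm_on {pd<..<pd + R} (\<lambda>p. u_h L N (w T) p - u T)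
        \<le> C * (mesh L N * exp pd * norm (u T) + \<epsilon> * norm u0)"
proof -
  define lp lm where "lp = lam_plus T A * T" and "lm = lam_minus T A * T"
  have lam: "0 \<le> lp" "0 \<le> lm" "lp \<le> pd"
    using lam_nonneg[OF spec_bdd] T_pos pd by (auto simp: lp_def lm_def)
  define B where "B = pd + \<bar>K\<bar> + lm"
  \<comment> \<open>\<open>C1\<close> serves the case \<open>b \<le> pi * L\<close>: the 3 bounds
    the square root of 8, and \<open>exp lm\<close> passes from \<open>u0\<close> to
    \<open>u T\<close>. \<open>C2\<close> serves the other case, where \<open>exp B\<close> is paid
    for by \<open>\<epsilon>\<close>.\<close>
  define C1 C2 where "C1 = 3 * \<bar>K\<bar> * exp lm" and "C2 = exp pd * \<bar>K\<bar> * sqrt (10 * B) * exp B"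
  have B: "0 \<le> B" and C: "0 \<le> C1" "0 \<le> C2"
    using lam by (auto simp: B_def C1_def C2_def)
  show ?thesis
  proof (intro exI[of _ "C1 + C2 + 1"] conjI allI impI)
    show "0 < C1 + C2 + 1" using C by simp
  next
    fix \<epsilon> R L :: real and N u0 u w
    assume eps: "\<epsilon> > 0" and R: "R \<ge> 1" "exp R \<le> K" and LN: "L > 0" "N > 0" "even N"
      and small: "exp (- pi * L + 2 * lam_plus T A * T + R) \<le> \<epsilon>"
      and ode: "solves_linear_ode T A u0 u" and schr: "solves_schroedingerized T A u0 L N w"
    let ?err = "L2_norm_on {pd<..<pd + R} (\<lambda>p. u_h L N (w T) p - u T)" and ?h = "mesh L N"
    \<comment> \<open>From \<open>1 + R \<le> exp R \<le> K\<close>; thus the right end of the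
      initial interval is at most \<open>B\<close>, whatever \<open>R\<close> is.\<close>
    have "R \<le> \<bar>K\<bar>" using R exp_ge_add_one_self[of R] by linarith
    then have b_le: "pd + R + lm \<le> B" by (simp add: B_def)
    have h: "0 \<le> ?h" using LN mesh_nonneg[of L N] by simp
    obtain c where w0: "\<And>p. w_h L N (w 0) p = trig_poly L N c p *s u0"
      and interp: "\<And>j. j < N \<Longrightarrow> trig_poly L N c (grid L N j) = exp (- \<bar>grid L N j\<bar>)"
      by (rule w_h_initial[OF schr LN(1,2)]) blast
    define X where "X = integral {pd - lp..pd + R + lm} (\<lambda>p. (cmod (trig_poly L N c p - exp (- p)))\<^sup>2)"
    have X_nonneg: "0 \<le> X"
      unfolding X_def
      by (intro integral_nonneg integrable_continuous_interval continuous_intros continuous_on_trig_poly) auto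
    have "?err \<le> exp (pd + R) * sqrt X * norm u0"
      using semidiscrete_L2_error_le[OF T_pos spec_bdd _ ode schr w0, of R pd] R
      by (simp add: X_def lp_def lm_def)
    also have "\<dots> \<le> exp pd * \<bar>K\<bar> * sqrt X * norm u0"
      using R X_nonneg unfolding exp_add
      by (intro mult_right_mono mult_left_mono) auto
    finally have err: "?err \<le> exp pd * \<bar>K\<bar> * sqrt X * norm u0" .
    show "?err \<le> (C1 + C2 + 1) * (?h * exp pd * norm (u T) + \<epsilon> * norm u0)"
    proof (cases "pd + R + lm \<le> pi * L")
      case True
      have "X \<le> 8 * ?h\<^sup>2"
        unfolding X_def using lam by (intro integral_initial_error_resolved LN True interp) auto
      also have "\<dots> \<le> (3 * ?h)\<^sup>2" by (simp add: power_mult_distrib)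
      finally have "sqrt X \<le> sqrt ((3 * ?h)\<^sup>2)" by (rule real_sqrt_le_mono)
      then have "sqrt X \<le> 3 * ?h" using h by (simp only: real_sqrt_abs)
      moreover have "norm u0 \<le> exp lm * norm (u T)"
        using norm_initial_le[OF T_pos spec_bdd ode] by (simp add: lm_def)
      ultimately have "exp pd * \<bar>K\<bar> * sqrt X * norm u0 \<le> exp pd * \<bar>K\<bar> * (3 * ?h) * (exp lm * norm (u T))"
        using h X_nonneg by (intro mult_mono) auto
      also have "\<dots> = C1 * (?h * exp pd * norm (u T))"
        by (simp add: C1_def)
      also have "\<dots> \<le> (C1 + C2 + 1) * (?h * exp pd * norm (u T) + \<epsilon> * norm u0)"
        using C h eps by (intro mult_mono) auto
      finally show ?thesis using err by linarith
    next
      case False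
      have "X \<le> 10 * (pd + R + lm)"
        unfolding X_def using lam R False
        by (intro integral_initial_error_unresolved[OF LN(1,2) _ _ _ interp]) auto
      also have "\<dots> \<le> 10 * B" using b_le by simp
      finally have X: "sqrt X \<le> sqrt (10 * B)" by simp
      \<comment> \<open>In this case \<open>pi * L < B\<close>, so the accuracy hypothesis forces
        \<open>\<epsilon>\<close> to be at least \<open>exp (- B)\<close>.\<close>
      have "exp (- B) \<le> exp (- pi * L + 2 * lam_plus T A * T + R)"
        using False b_le lam R by (simp add: lp_def)
      then have "exp (- B) \<le> \<epsilon>" using small by linarith
      then have "1 \<le> exp B * \<epsilon>" by (simp add: exp_minus field_simps)
      then have "1 * norm u0 \<le> exp B * \<epsilon> * norm u0" by (intro mult_right_mono) auto
      then have "exp pd * \<bar>K\<bar> * sqrt X * norm u0 \<le> exp pd * \<bar>K\<bar> * sqrt (10 * B) * (exp B * \<epsilon> * norm u0)"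
        using X X_nonneg B by (intro mult_mono) auto
      also have "\<dots> = C2 * (\<epsilon> * norm u0)"
        by (simp add: C2_def)
      also have "\<dots> \<le> (C1 + C2 + 1) * (?h * exp pd * norm (u T) + \<epsilon> * norm u0)"
        using C h eps by (intro mult_mono) auto
      finally show ?thesis using err by linarith
    qed
  qed
qed

end
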